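(* The following problem is decidable: given a session automaton $\mathcal A$ and a dMSO sentence $\phi$, decide whether $L(\mathcal A)\subseteq L(\phi)$.
   Context: $\Sigma$ is a non-empty finite alphabet, $D$ an infinite set of data values; data words are elements of $(\Sigma\times D)^*$. A session automaton $(S,\mathcal R,\iota,F,\Delta)$ has finite non-empty state set $S$, finite non-empty register set $\mathcal R$, initial state $\iota$, final states $F$, and finitely many transitions $(s,(a,\pi),s')$ with $a\in\Sigma$, $\pi\in\{r^\circledast,r^\uparrow:r\in\mathcal R\}$; configurations $(s,\tau,U)$ with $\tau:\mathcal R\rightharpoonup D$ partial, $U\subseteq D$; reading $(a,d)$ on register $r$ requires $d=\tau(r)$ for $r^\uparrow$ and $d\notin U$ for $r^\circledast$, then sets $\tau(r):=d$, $U:=U\cup\{d\}$; runs start in $(\iota,\emptyset,\emptyset)$ and $L(\mathcal A)$ is the set of data words with a run ending in $F$. dMSO formulas: $\phi::=\mathrm{label}(x)=a\mid x=y\mid y=x+1\mid x\sim y\mid x\in X\mid\neg\phi\mid\phi\lor\phi\mid\exists x\,\phi\mid\exists X\,\phi$, interpreted over a data word $(a_1,d_1)\cdots(a_n,d_n)$ with first-order variables ranging over positions, second-order variables over sets of positions; $\mathrm{label}(x)=a$ means $a_x=a$, $y=x+1$ is successor, $x\sim y$ means $d_x=d_y$, other constructs standard. For a sentence $\phi$, $L(\phi)$ is the set of data words satisfying $\phi$. *)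

theory Defs
  imports Main "HOL-Library.Nat_Bijection"
begin

section \<open>Recursive functions and decidable problems\<close>

text \<open>
  \<open>recursive_fn n f\<close>: \<open>f\<close> is a (total) recursive function of \<open>n\<close> arguments. The arguments are
  passed as a list; only the values of \<open>f\<close> on lists of length \<open>n\<close> are meaningful. Minimization is
  applied to regular functions only, so that the class consists of total functions.
\<close>

inductive recursive_fn :: "nat \<Rightarrow> (nat list \<Rightarrow> nat) \<Rightarrow> bool" where
  zero: "recursive_fn n (\<lambda>_. 0)"
| succ: "recursive_fn 1 (\<lambda>xs. Suc (hd xs))"
| proj: "i < n \<Longrightarrow> recursive_fn n (\<lambda>xs. xs ! i)"
| comp: "recursive_fn (length gs) f \<Longrightarrow> \<forall>g \<in> set gs. recursive_fn n g \<Longrightarrow>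
    recursive_fn n (\<lambda>xs. f (map (\<lambda>g. g xs) gs))"
| prim_rec: "recursive_fn n f \<Longrightarrow> recursive_fn (n + 2) g \<Longrightarrow>
    recursive_fn (n + 1) (\<lambda>xs. rec_nat (f (tl xs)) (\<lambda>k r. g (k # r # tl xs)) (hd xs))"
| minimize: "recursive_fn (n + 1) f \<Longrightarrow> \<forall>xs. length xs = n \<longrightarrow> (\<exists>y. f (y # xs) = 0) \<Longrightarrow>
    recursive_fn n (\<lambda>xs. LEAST y. f (y # xs) = 0)"

text \<open>
  A decision problem is given by its set of instances \<open>I\<close>, a coding of the instances by natural
  numbers (required to be injective on \<open>I\<close>), and the property \<open>P\<close> to be decided.
\<close>

definition decidable_problem :: "('i \<Rightarrow> nat) \<Rightarrow> 'i set \<Rightarrow> ('i \<Rightarrow> bool) \<Rightarrow> bool" where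
  "decidable_problem code I P \<longleftrightarrow> inj_on code I \<and>
    (\<exists>f. recursive_fn 1 f \<and> (\<forall>x \<in> I. f [code x] = (if P x then 1 else 0)))"


section \<open>Session automata\<close>

text \<open>\<open>Fresh r\<close> is $r^\circledast$ and \<open>Reuse r\<close> is $r^\uparrow$.\<close>

datatype 'r reg_op = Fresh 'r | Reuse 'r

record ('s, 'r, 'a) session_automaton =
  states :: "'s set"
  registers :: "'r set"
  initial :: 's
  final :: "'s set"
  transitions :: "('s \<times> ('a \<times> 'r reg_op) \<times> 's) set"

definition is_session_automaton :: "('s, 'r, 'a) session_automaton \<Rightarrow> bool" where
  "is_session_automaton A \<longleftrightarrow>
    finite (states A) \<and> states A \<noteq> {} \<and>
    finite (registers A) \<and> registers A \<noteq> {} \<and>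
    initial A \<in> states A \<and> final A \<subseteq> states A \<and>
    finite (transitions A) \<and>
    transitions A \<subseteq>
      states A \<times> (UNIV \<times> (Fresh ` registers A \<union> Reuse ` registers A)) \<times> states A"

type_synonym ('s, 'r, 'd) config = "'s \<times> ('r \<rightharpoonup> 'd) \<times> 'd set"

inductive step :: "('s, 'r, 'a) session_automaton \<Rightarrow>
    ('s, 'r, 'd) config \<Rightarrow> 'a \<times> 'd \<Rightarrow> ('s, 'r, 'd) config \<Rightarrow> bool" for A where
  fresh: "(s, (a, Fresh r), s') \<in> transitions A \<Longrightarrow> d \<notin> U \<Longrightarrow>
    step A (s, \<tau>, U) (a, d) (s', \<tau>(r \<mapsto> d), U \<union> {d})"
| reuse: "(s, (a, Reuse r), s') \<in> transitions A \<Longrightarrow> \<tau> r = Some d \<Longrightarrow>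
    step A (s, \<tau>, U) (a, d) (s', \<tau>(r \<mapsto> d), U \<union> {d})"

inductive run :: "('s, 'r, 'a) session_automaton \<Rightarrow>
    ('s, 'r, 'd) config \<Rightarrow> ('a \<times> 'd) list \<Rightarrow> ('s, 'r, 'd) config \<Rightarrow> bool" for A where
  Nil: "run A c [] c"
| Cons: "step A c x c' \<Longrightarrow> run A c' w c'' \<Longrightarrow> run A c (x # w) c''"

definition automaton_lang :: "('s, 'r, 'a) session_automaton \<Rightarrow> ('a \<times> 'd) list set" where
  "automaton_lang A =
    {w. \<exists>s \<tau> U. run A (initial A, Map.empty, {}) w (s, \<tau>, U) \<and> s \<in> final A}"


section \<open>Data MSO\<close>

text \<open>
  First-order and second-order variables are two disjoint copies of the natural numbers.
  \<open>Succ x y\<close> is the atom $y = x + 1$.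
\<close>

datatype 'a dmso =
    Label nat 'a
  | Eq nat nat
  | Succ nat nat
  | Sim nat nat
  | Mem nat nat
  | Neg "'a dmso"
  | Or "'a dmso" "'a dmso"
  | Ex1 nat "'a dmso"
  | Ex2 nat "'a dmso"

text \<open>The positions of a data word \<open>w\<close> are numbered \<open>0, \<dots>, length w - 1\<close>.\<close>

primrec sat :: "('a \<times> 'd) list \<Rightarrow> (nat \<Rightarrow> nat) \<Rightarrow> (nat \<Rightarrow> nat set) \<Rightarrow> 'a dmso \<Rightarrow> bool" where
  "sat w \<sigma> \<rho> (Label x a) \<longleftrightarrow> fst (w ! \<sigma> x) = a"
| "sat w \<sigma> \<rho> (Eq x y) \<longleftrightarrow> \<sigma> x = \<sigma> y"
| "sat w \<sigma> \<rho> (Succ x y) \<longleftrightarrow> \<sigma> y = \<sigma> x + 1"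
| "sat w \<sigma> \<rho> (Sim x y) \<longleftrightarrow> snd (w ! \<sigma> x) = snd (w ! \<sigma> y)"
| "sat w \<sigma> \<rho> (Mem x X) \<longleftrightarrow> \<sigma> x \<in> \<rho> X"
| "sat w \<sigma> \<rho> (Neg \<phi>) \<longleftrightarrow> \<not> sat w \<sigma> \<rho> \<phi>"
| "sat w \<sigma> \<rho> (Or \<phi> \<psi>) \<longleftrightarrow> sat w \<sigma> \<rho> \<phi> \<or> sat w \<sigma> \<rho> \<psi>"
| "sat w \<sigma> \<rho> (Ex1 x \<phi>) \<longleftrightarrow> (\<exists>i < length w. sat w (\<sigma>(x := i)) \<rho> \<phi>)"
| "sat w \<sigma> \<rho> (Ex2 X \<phi>) \<longleftrightarrow> (\<exists>M \<subseteq> {..<length w}. sat w \<sigma> (\<rho>(X := M)) \<phi>)"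

primrec free1 :: "'a dmso \<Rightarrow> nat set" where
  "free1 (Label x a) = {x}"
| "free1 (Eq x y) = {x, y}"
| "free1 (Succ x y) = {x, y}"
| "free1 (Sim x y) = {x, y}"
| "free1 (Mem x X) = {x}"
| "free1 (Neg \<phi>) = free1 \<phi>"
| "free1 (Or \<phi> \<psi>) = free1 \<phi> \<union> free1 \<psi>"
| "free1 (Ex1 x \<phi>) = free1 \<phi> - {x}"
| "free1 (Ex2 X \<phi>) = free1 \<phi>"

primrec free2 :: "'a dmso \<Rightarrow> nat set" where
  "free2 (Label x a) = {}"
| "free2 (Eq x y) = {}"
| "free2 (Succ x y) = {}"
| "free2 (Sim x y) = {}"
| "free2 (Mem x X) = {X}"
| "free2 (Neg \<phi>) = free2 \<phi>"
| "free2 (Or \<phi> \<psi>) = free2 \<phi> \<union> free2 \<psi>"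
| "free2 (Ex1 x \<phi>) = free2 \<phi>"
| "free2 (Ex2 X \<phi>) = free2 \<phi> - {X}"

definition is_sentence :: "'a dmso \<Rightarrow> bool" where
  "is_sentence \<phi> \<longleftrightarrow> free1 \<phi> = {} \<and> free2 \<phi> = {}"

text \<open>The interpretation chosen here is immaterial for sentences, see \<open>sat_sentence\<close> below.\<close>

definition dmso_lang :: "'a dmso \<Rightarrow> ('a \<times> 'd) list set" where
  "dmso_lang \<phi> = {w. sat w (\<lambda>_. 0) (\<lambda>_. {}) \<phi>}"

lemma sat_cong:
  assumes "\<And>x. x \<in> free1 \<phi> \<Longrightarrow> \<sigma> x = \<sigma>' x" and "\<And>X. X \<in> free2 \<phi> \<Longrightarrow> \<rho> X = \<rho>' X"
  shows "sat w \<sigma> \<rho> \<phi> \<longleftrightarrow> sat w \<sigma>' \<rho>' \<phi>"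
  using assms
proof (induction \<phi> arbitrary: \<sigma> \<sigma>' \<rho> \<rho>')
  case (Or \<phi> \<psi>)
  have "sat w \<sigma> \<rho> \<phi> \<longleftrightarrow> sat w \<sigma>' \<rho>' \<phi>" by (rule Or.IH(1)) (use Or.prems in auto)
  moreover have "sat w \<sigma> \<rho> \<psi> \<longleftrightarrow> sat w \<sigma>' \<rho>' \<psi>" by (rule Or.IH(2)) (use Or.prems in auto)
  ultimately show ?case by simp
next
  case (Ex1 x \<phi>)
  have "sat w (\<sigma>(x := i)) \<rho> \<phi> \<longleftrightarrow> sat w (\<sigma>'(x := i)) \<rho>' \<phi>" for i
    by (rule Ex1.IH) (use Ex1.prems in auto)
  then show ?case by simp
next
  case (Ex2 X \<phi>)
  have "sat w \<sigma> (\<rho>(X := M)) \<phi> \<longleftrightarrow> sat w \<sigma>' (\<rho>'(X := M)) \<phi>" for M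
    by (rule Ex2.IH) (use Ex2.prems in auto)
  then show ?case by simp
next
  case (Neg \<phi>)
  have "sat w \<sigma> \<rho> \<phi> \<longleftrightarrow> sat w \<sigma>' \<rho>' \<phi>" by (rule Neg.IH) (use Neg.prems in auto)
  then show ?case by simp
qed auto

lemma sat_sentence: "is_sentence \<phi> \<Longrightarrow> sat w \<sigma> \<rho> \<phi> \<longleftrightarrow> w \<in> dmso_lang \<phi>"
  unfolding dmso_lang_def mem_Collect_eq by (rule sat_cong) (auto simp: is_sentence_def)


section \<open>Coding of automata and formulas\<close>

text \<open>
  As inputs of an algorithm, automata have natural numbers as states and registers. The parameter
  \<open>e\<close> numbers the letters of the alphabet.
\<close>

primrec reg_op_code :: "nat reg_op \<Rightarrow> nat" where
  "reg_op_code (Fresh r) = prod_encode (0, r)"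
| "reg_op_code (Reuse r) = prod_encode (1, r)"

definition transition_code :: "('a \<Rightarrow> nat) \<Rightarrow> nat \<times> ('a \<times> nat reg_op) \<times> nat \<Rightarrow> nat" where
  "transition_code e = (\<lambda>(s, (a, p), s'). list_encode [s, e a, reg_op_code p, s'])"

definition automaton_code :: "('a \<Rightarrow> nat) \<Rightarrow> (nat, nat, 'a) session_automaton \<Rightarrow> nat" where
  "automaton_code e A = list_encode
    [set_encode (states A), set_encode (registers A), initial A, set_encode (final A),
     set_encode (transition_code e ` transitions A)]"

primrec dmso_code :: "('a \<Rightarrow> nat) \<Rightarrow> 'a dmso \<Rightarrow> nat" where
  "dmso_code e (Label x a) = list_encode [0, x, e a]"
| "dmso_code e (Eq x y) = list_encode [1, x, y]"
| "dmso_code e (Succ x y) = list_encode [2, x, y]"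
| "dmso_code e (Sim x y) = list_encode [3, x, y]"
| "dmso_code e (Mem x X) = list_encode [4, x, X]"
| "dmso_code e (Neg \<phi>) = list_encode [5, dmso_code e \<phi>]"
| "dmso_code e (Or \<phi> \<psi>) = list_encode [6, dmso_code e \<phi>, dmso_code e \<psi>]"
| "dmso_code e (Ex1 x \<phi>) = list_encode [7, x, dmso_code e \<phi>]"
| "dmso_code e (Ex2 X \<phi>) = list_encode [8, X, dmso_code e \<phi>]"

definition instance_code ::
    "('a \<Rightarrow> nat) \<Rightarrow> (nat, nat, 'a) session_automaton \<times> 'a dmso \<Rightarrow> nat" where
  "instance_code e = (\<lambda>(A, \<phi>). prod_encode (automaton_code e A, dmso_code e \<phi>))"

lemma reg_op_code_eq_iff [simp]: "reg_op_code p = reg_op_code q \<longleftrightarrow> p = q"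
  by (cases p; cases q) auto

lemma inj_transition_code: "inj e \<Longrightarrow> inj (transition_code e)"
  by (auto simp: inj_def transition_code_def list_encode_eq simp del: list_encode.simps)

lemma dmso_code_eqD: "inj e \<Longrightarrow> dmso_code e \<phi> = dmso_code e \<psi> \<Longrightarrow> \<phi> = \<psi>"
proof (induction \<phi> arbitrary: \<psi>)
qed (case_tac \<psi>; simp add: list_encode_eq inj_eq del: list_encode.simps)+

lemma inj_on_instance_code:
  assumes "inj e"
  shows "inj_on (instance_code e) {(A, \<phi>). is_session_automaton A \<and> is_sentence \<phi>}"
proof -
  have "A = B" if A: "is_session_automaton A" and B: "is_session_automaton B"
    and eq: "automaton_code e A = automaton_code e B" for A B
  proof -
    have fin: "finite (states X)" "finite (registers X)" "finite (final X)"
      "finite (transition_code e ` transitions X)"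
      if "is_session_automaton X" for X :: "(nat, nat, 'a) session_automaton"
      using that by (auto simp: is_session_automaton_def intro: finite_subset)
    have "states A = states B" "registers A = registers B" "initial A = initial B"
      "final A = final B" "transition_code e ` transitions A = transition_code e ` transitions B"
      using eq fin[OF A] fin[OF B]
      by (simp_all add: automaton_code_def list_encode_eq set_encode_eq del: list_encode.simps)
    then show ?thesis
      using inj_transition_code[OF assms] by (simp add: inj_image_eq_iff)
  qed
  then show ?thesis
    using dmso_code_eqD[OF assms] by (auto simp: inj_on_def instance_code_def)
qed

end

theory Submission
  imports Defs
begin

text \<open>
  Two positions of a run of a session automaton carry the same data value iff they use the same
  register and the register is not refreshed in between. Hence satisfaction of a sentence depends
  only on the sequence of transitions, a word over a finite alphabet, and inclusion fails iff
  some accepting sequence of transitions, in which every register is initialized before it is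
  reused, violates the sentence. On such words a formula is decided by a finite automaton whose
  number of states is bounded by a tower of exponentials in the size of the formula: atoms need few
  states, disjunction is a product, and quantifiers are handled by the subset construction. By
  pumping, a shortest counterexample is no longer than a bound that is computable from the instance
  code, which itself bounds all numbers of states, registers and variables. No automaton has to be
  constructed: the decision procedure evaluates the sentence on all sequences up to the bound.
\<close>

section \<open>Recursive functions and relations\<close>

text \<open>Data values can be forgotten because a value written by \<open>Fresh\<close> must not
  have occurred anywhere before: distinct sessions never share a value, even in the same register.
  Conversely, an infinite data domain can serve every \<open>Fresh\<close>, so each initialized
  transition sequence stems from a run. Decidability demands one explicit recursive function on
  codes, and manipulating coded automata would be laborious to verify. So automata enter only
  through the existence of a right congruence and a bound on its index; that bound alone is
  computed. A congruence has to saturate its property only on words with well-formed variable marks,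
  which makes negation free. Evaluation meets another obstacle: a quantifier calls its body with
  many environments, which is not recursion on a single value. Tables over all pairs of formula and
  environment restore that form.\<close>

text \<open>
  Closure of \<open>recursive_fn n\<close> under equality on lists of length \<open>n\<close>. In the closure rules below the
  argument list is a context: binding a variable pushes it to the front, so that \<open>hd\<close> and \<open>tl\<close> act
  as de Bruijn indices and every rule can be applied backwards to a lambda term.
\<close>

definition computable :: "nat \<Rightarrow> (nat list \<Rightarrow> nat) \<Rightarrow> bool" where
  "computable n f \<longleftrightarrow> (\<exists>g. recursive_fn n g \<and> (\<forall>xs. length xs = n \<longrightarrow> f xs = g xs))"

definition computable_rel :: "nat \<Rightarrow> (nat list \<Rightarrow> bool) \<Rightarrow> bool" where
  "computable_rel n P \<longleftrightarrow> computable n (\<lambda>xs. of_bool (P xs))"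

lemma computable_recursive: "recursive_fn n g \<Longrightarrow> computable n g"
  unfolding computable_def by blast

lemma computable_cong:
  "computable n g \<Longrightarrow> (\<And>xs. length xs = n \<Longrightarrow> f xs = g xs) \<Longrightarrow> computable n f"
  unfolding computable_def by metis

lemma computable_comp:
  assumes "computable (length gs) f" "\<And>g. g \<in> set gs \<Longrightarrow> computable n g"
  shows "computable n (\<lambda>xs. f (map (\<lambda>g. g xs) gs))"
proof -
  obtain f' where f': "recursive_fn (length gs) f'" "\<And>xs. length xs = length gs \<Longrightarrow> f xs = f' xs"
    using assms(1) unfolding computable_def by blast
  obtain G where G: "\<And>g. g \<in> set gs \<Longrightarrow> recursive_fn n (G g)"
    "\<And>g xs. g \<in> set gs \<Longrightarrow> length xs = n \<Longrightarrow> g xs = G g xs"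
    using assms(2) unfolding computable_def by metis
  have "recursive_fn n (\<lambda>xs. f' (map (\<lambda>g. g xs) (map G gs)))"
    by (rule recursive_fn.comp) (use f' G in auto)
  moreover have "f (map (\<lambda>g. g xs) gs) = f' (map (\<lambda>g. g xs) (map G gs))" if "length xs = n" for xs
    using f' G that by (simp add: comp_def cong: map_cong)
  ultimately show ?thesis unfolding computable_def by blast
qed

lemma computable_nth: "i < n \<Longrightarrow> computable n (\<lambda>xs. xs ! i)"
  by (rule computable_recursive[OF recursive_fn.proj])

lemma computable_hd: "computable (Suc n) hd"
  by (rule computable_cong[OF computable_nth[of 0]]) (simp, metis hd_conv_nth list.size(3) nat.distinct(1))

text \<open>Common source of the de Bruijn manipulations: empty \<open>gs\<close> with
  \<open>k = 1\<close> is weakening, \<open>k = 0\<close> is substitution for a bound variable, and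
  \<open>k = 2\<close> rewrites the counter and accumulator of a recursion. The untouched arguments
  are projections.\<close>

lemma computable_append_args:
  assumes "computable (length gs + n) f" "\<And>g. g \<in> set gs \<Longrightarrow> computable (k + n) g"
  shows "computable (k + n) (\<lambda>xs. f (map (\<lambda>g. g xs) gs @ drop k xs))"
proof -
  let ?ps = "map (\<lambda>i xs. xs ! (k + i)) [0..<n]"
  have "computable (k + n) (\<lambda>xs. f (map (\<lambda>g. g xs) (gs @ ?ps)))"
    by (rule computable_comp) (use assms in \<open>auto intro: computable_nth\<close>)
  moreover have "map (\<lambda>g. g xs) (gs @ ?ps) = map (\<lambda>g. g xs) gs @ drop k xs"
    if "length xs = k + n" for xs
    using that by (auto simp: list_eq_iff_nth_eq nth_append)
  ultimately show ?thesis by (auto elim: computable_cong)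
qed

lemma computable_tl: "computable n f \<Longrightarrow> computable (Suc n) (\<lambda>xs. f (tl xs))"
  using computable_append_args[of "[]" n f 1] by (simp add: drop_Suc)

lemma computable_subst_hd:
  assumes "computable (Suc n) (\<lambda>ys. f (hd ys) (tl ys))" "computable n g"
  shows "computable n (\<lambda>xs. f (g xs) xs)"
  using computable_append_args[of "[g]" n "\<lambda>ys. f (hd ys) (tl ys)" 0] assms by simp

lemma computable_comp1:
  assumes "computable (Suc 0) (\<lambda>xs. F (hd xs))" "computable n f"
  shows "computable n (\<lambda>xs. F (f xs))"
  using computable_comp[of "[f]" "\<lambda>xs. F (hd xs)" n] assms by simp

lemma computable_rec_nat:
  assumes "computable n f" "computable (Suc (Suc n)) (\<lambda>ys. g (hd ys) (hd (tl ys)) (tl (tl ys)))"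
    "computable n h"
  shows "computable n (\<lambda>xs. rec_nat (f xs) (\<lambda>k r. g k r xs) (h xs))"
proof -
  obtain f' where f': "recursive_fn n f'" "\<And>xs. length xs = n \<Longrightarrow> f xs = f' xs"
    using assms(1) unfolding computable_def by blast
  obtain g' where g': "recursive_fn (n + 2) g'"
    "\<And>ys. length ys = n + 2 \<Longrightarrow> g (hd ys) (hd (tl ys)) (tl (tl ys)) = g' ys"
    using assms(2) unfolding computable_def by auto
  have *: "rec_nat (f xs) (\<lambda>k r. g k r xs) m = rec_nat (f' xs) (\<lambda>k r. g' (k # r # xs)) m"
    if "length xs = n" for xs m
    using that f'(2) g'(2)[of "_ # _ # xs"] by (induction m) auto
  have "computable (Suc n) (\<lambda>xs. rec_nat (f (tl xs)) (\<lambda>k r. g k r (tl xs)) (hd xs))"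
    by (rule computable_cong[OF computable_recursive])
      (use recursive_fn.prim_rec[OF f'(1) g'(1)] in simp, use * in auto)
  then show ?thesis
    using computable_subst_hd[of n "\<lambda>y xs. rec_nat (f xs) (\<lambda>k r. g k r xs) y" h] assms(3) by blast
qed

lemma computable_zero: "computable n (\<lambda>_. 0)"
  by (rule computable_recursive[OF recursive_fn.zero])

lemma computable_Suc: "computable n f \<Longrightarrow> computable n (\<lambda>xs. Suc (f xs))"
  by (rule computable_comp1) (use recursive_fn.succ computable_recursive in auto)

lemma computable_const: "computable n (\<lambda>_. k)"
  by (induction k) (auto intro: computable_zero computable_Suc)

lemma computable_add:
  assumes "computable n f" "computable n g"
  shows "computable n (\<lambda>xs. f xs + g xs)"
proof -
  have "x + y = rec_nat y (\<lambda>_ r. Suc r) x" for x y by (induction x) auto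
  then show ?thesis
    by simp (rule computable_rec_nat computable_Suc computable_hd computable_tl assms)+
qed

lemma computable_mult:
  assumes "computable n f" "computable n g"
  shows "computable n (\<lambda>xs. f xs * g xs)"
proof -
  have "x * y = rec_nat 0 (\<lambda>_ r. r + y) x" for x y :: nat by (induction x) auto
  then show ?thesis
    by simp (rule computable_rec_nat computable_add computable_zero computable_hd computable_tl assms)+
qed

lemma computable_power:
  assumes "computable n f" "computable n g"
  shows "computable n (\<lambda>xs. f xs ^ g xs)"
proof -
  have "x ^ y = rec_nat 1 (\<lambda>_ r. x * r) y" for x y :: nat by (induction y) auto
  then show ?thesis
    by (simp del: One_nat_def)
      (rule computable_rec_nat computable_mult computable_const computable_hd computable_tl assms)+
qed

lemma computable_diff:
  assumes "computable n f" "computable n g"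
  shows "computable n (\<lambda>xs. f xs - g xs)"
proof -
  have "x - 1 = rec_nat 0 (\<lambda>k _. k) x" for x :: nat by (cases x) auto
  then have pred: "computable m (\<lambda>xs. h xs - 1)" if "computable m h" for m h
    by (simp del: One_nat_def) (rule computable_rec_nat computable_zero computable_hd computable_tl that)+
  have "x - y = rec_nat x (\<lambda>_ r. r - 1) y" for x y :: nat by (induction y) auto
  then have "(\<lambda>xs. f xs - g xs) = (\<lambda>xs. rec_nat (f xs) (\<lambda>_ r. r - 1) (g xs))" by (rule ext)
  then show ?thesis
    by (simp only:) (rule computable_rec_nat pred computable_hd computable_tl assms)+
qed

lemma computable_of_bool: "computable_rel n P \<Longrightarrow> computable n (\<lambda>xs. of_bool (P xs))"
  by (simp add: computable_rel_def)

lemma computable_rel_const: "computable_rel n (\<lambda>_. b)"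
  unfolding computable_rel_def by (rule computable_const)

lemma computable_rel_not:
  assumes "computable_rel n P"
  shows "computable_rel n (\<lambda>xs. \<not> P xs)"
proof -
  have "of_bool (\<not> b) = 1 - (of_bool b :: nat)" for b by simp
  then show ?thesis
    unfolding computable_rel_def
    by (simp only:) (intro computable_diff computable_const computable_of_bool assms)
qed

lemma computable_rel_conj:
  "computable_rel n P \<Longrightarrow> computable_rel n Q \<Longrightarrow> computable_rel n (\<lambda>xs. P xs \<and> Q xs)"
  unfolding computable_rel_def of_bool_conj by (intro computable_mult)

lemma computable_rel_disj:
  assumes "computable_rel n P" "computable_rel n Q"
  shows "computable_rel n (\<lambda>xs. P xs \<or> Q xs)"
  using computable_rel_not[OF computable_rel_conj[OF assms[THEN computable_rel_not]]] by simp

lemma computable_rel_imp: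
  assumes "computable_rel n P" "computable_rel n Q"
  shows "computable_rel n (\<lambda>xs. P xs \<longrightarrow> Q xs)"
  unfolding imp_conv_disj by (intro computable_rel_disj computable_rel_not assms)

lemma computable_rel_le:
  assumes "computable n f" "computable n g"
  shows "computable_rel n (\<lambda>xs. f xs \<le> g xs)"
proof -
  have "of_bool (x \<le> y) = 1 - (x - y)" for x y :: nat by auto
  then show ?thesis
    unfolding computable_rel_def by (simp only:) (intro computable_diff computable_const assms)
qed

lemma computable_rel_less:
  "computable n f \<Longrightarrow> computable n g \<Longrightarrow> computable_rel n (\<lambda>xs. f xs < g xs)"
  unfolding not_le[symmetric] by (intro computable_rel_not computable_rel_le)

lemma computable_rel_eq:
  "computable n f \<Longrightarrow> computable n g \<Longrightarrow> computable_rel n (\<lambda>xs. f xs = g xs)"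
  unfolding eq_iff by (intro computable_rel_conj computable_rel_le)

lemma computable_if:
  assumes "computable_rel n P" "computable n f" "computable n g"
  shows "computable n (\<lambda>xs. if P xs then f xs else g xs)"
proof -
  have "(if b then x else y) = of_bool b * x + of_bool (\<not> b) * y" for b and x y :: nat by auto
  then show ?thesis
    by (simp only:)
      (intro computable_add computable_mult computable_of_bool computable_rel_not assms)
qed

lemma computable_rel_ex:
  assumes "computable_rel (Suc n) (\<lambda>ys. P (hd ys) (tl ys))" "computable n g"
  shows "computable_rel n (\<lambda>xs. \<exists>i < g xs. P i xs)"
proof -
  have ex: "of_bool (\<exists>i < m. P i xs) =
    rec_nat (0 :: nat) (\<lambda>k r. if P k xs then 1 else r) m" for m xs
  proof (induction m)
    case (Suc m)
    show ?case by (auto simp: less_Suc_eq simp flip: Suc.IH)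
  qed simp
  \<comment> \<open>Inside the recursion the accumulator sits between the counter and the outer
    arguments; \<open>P\<close> has to skip it.\<close>
  have "computable_rel (Suc (Suc n)) (\<lambda>ys. P (hd ys) (tl (tl ys)))"
    using assms(1) computable_append_args[of "[hd]" n "\<lambda>ys. of_bool (P (hd ys) (tl ys))" 2]
    by (simp add: computable_rel_def computable_hd numeral_2_eq_2 drop_Suc)
  then show ?thesis
    by (subst computable_rel_def, unfold ex)
      (rule computable_rec_nat computable_if computable_const computable_hd computable_tl assms
        | assumption)+
qed

lemma computable_rel_all:
  assumes "computable_rel (Suc n) (\<lambda>ys. P (hd ys) (tl ys))" "computable n g"
  shows "computable_rel n (\<lambda>xs. \<forall>i < g xs. P i xs)"
  using computable_rel_not[OF computable_rel_ex[OF computable_rel_not[OF assms(1)] assms(2)]] by simp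

text \<open>The only use of minimization. The existence hypothesis makes the function regular; since
  minimization looks for a zero, it is applied to the negation of \<open>P\<close>.\<close>

lemma computable_Least:
  assumes "computable_rel (Suc n) (\<lambda>ys. P (hd ys) (tl ys))"
    "\<And>xs. length xs = n \<Longrightarrow> \<exists>y. P y xs"
  shows "computable n (\<lambda>xs. LEAST y. P y xs)"
proof -
  obtain g where g: "recursive_fn (n + 1) g"
    "\<And>ys. length ys = Suc n \<Longrightarrow> of_bool (\<not> P (hd ys) (tl ys)) = g ys"
    using computable_rel_not[OF assms(1)] unfolding computable_rel_def computable_def by auto
  have g0: "g (y # xs) = 0 \<longleftrightarrow> P y xs" if "length xs = n" for y xs
    using g(2)[of "y # xs", symmetric] that by simp
  have "recursive_fn n (\<lambda>xs. LEAST y. g (y # xs) = 0)"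
    by (rule recursive_fn.minimize) (use g(1) g0 assms(2) in auto)
  then show ?thesis
    by (rule computable_cong[OF computable_recursive]) (simp add: g0)
qed

lemmas computable_arith_intros =
  computable_hd computable_const computable_Suc computable_add computable_mult computable_power
  computable_diff computable_if computable_of_bool computable_rel_const computable_rel_not
  computable_rel_conj computable_rel_disj computable_rel_imp computable_rel_le computable_rel_less
  computable_rel_eq computable_rel_ex computable_rel_all computable_tl

section \<open>Pairs, finite sets and lists as numbers\<close>

lemma computable_prod_encode:
  assumes "computable n f" "computable n g"
  shows "computable n (\<lambda>xs. prod_encode (f xs, g xs))"
proof -
  have "triangle x = rec_nat 0 (\<lambda>k r. r + Suc k) x" for x by (induction x) auto
  then show ?thesis
    unfolding prod_encode_def prod.case
    by (simp del: add_Suc_right) (rule computable_rec_nat computable_arith_intros assms)+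
qed

text \<open>Searching is simpler than inverting triangular numbers: the partner component is at most
  \<open>z\<close>, so a bounded quantifier covers it, and decoding \<open>z\<close> shows that the
  search succeeds.\<close>

lemma computable_fst_decode:
  assumes "computable n f"
  shows "computable n (\<lambda>xs. fst (prod_decode (f xs)))"
proof -
  have eq: "fst (prod_decode z) = (LEAST y. \<exists>i < Suc z. prod_encode (y, i) = z)" for z
  proof -
    have "(\<exists>i < Suc z. prod_encode (y, i) = z) \<longleftrightarrow> y = fst (prod_decode z)" for y
      by (metis le_imp_less_Suc le_prod_encode_2 prod.collapse fst_conv prod_encode_inverse prod_decode_inverse)
    then show ?thesis by (simp add: Least_equality)
  qed
  show ?thesis
    by (rule computable_comp1[OF _ assms], unfold eq, rule computable_Least)
      ((rule computable_prod_encode computable_arith_intros)+,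
        metis le_imp_less_Suc le_prod_encode_2 prod_decode_inverse prod.collapse)
qed

lemma computable_snd_decode:
  assumes "computable n f"
  shows "computable n (\<lambda>xs. snd (prod_decode (f xs)))"
proof -
  have eq: "snd (prod_decode z) = (LEAST y. \<exists>i < Suc z. prod_encode (i, y) = z)" for z
  proof -
    have "(\<exists>i < Suc z. prod_encode (i, y) = z) \<longleftrightarrow> y = snd (prod_decode z)" for y
      by (metis le_imp_less_Suc le_prod_encode_1 prod.collapse snd_conv prod_encode_inverse prod_decode_inverse)
    then show ?thesis by (simp add: Least_equality)
  qed
  show ?thesis
    by (rule computable_comp1[OF _ assms], unfold eq, rule computable_Least)
      ((rule computable_prod_encode computable_arith_intros)+,
        metis le_imp_less_Suc le_prod_encode_1 prod_decode_inverse prod.collapse)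
qed

text \<open>Membership is the bit test \<open>odd (y div 2 ^ x)\<close>. The division is
  \<open>x\<close> halvings, a halving is a search for the least \<open>y\<close> with
  \<open>z < 2 * y + 2\<close>, and parity compares a number with twice its half.\<close>

lemma computable_rel_set_decode:
  assumes "computable n f" "computable n g"
  shows "computable_rel n (\<lambda>xs. f xs \<in> set_decode (g xs))"
proof -
  have half: "z div 2 = (LEAST y. z < 2 * y + 2)" for z :: nat
    by (rule Least_equality[symmetric]) auto
  have half_comp: "computable m (\<lambda>xs. h xs div 2)" if "computable m h" for m h
    by (rule computable_comp1[OF _ that], unfold half, rule computable_Least)
      ((rule computable_arith_intros)+, presburger)
  have iter: "y div 2 ^ x = rec_nat y (\<lambda>_ r. r div 2) x" for x y :: nat
    by (induction x) (simp_all add: div_mult2_eq power_Suc2 del: power_Suc)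
  have odd_iff: "odd z \<longleftrightarrow> \<not> z = 2 * (z div 2)" for z :: nat by presburger
  have "x \<in> set_decode y \<longleftrightarrow>
    \<not> rec_nat y (\<lambda>_ r. r div 2) x = 2 * (rec_nat y (\<lambda>_ r. r div 2) x div 2)" for x y
    unfolding set_decode_def mem_Collect_eq iter[symmetric] by (rule odd_iff)
  then show ?thesis
    by (simp only:) (rule computable_rec_nat half_comp computable_arith_intros assms)+
qed

text \<open>Undoes the shape \<open>Suc (prod_encode (head, tail))\<close> of a nonempty list code:
  \<open>i\<close> tails, then a head. An index beyond the end yields 0.\<close>

definition code_nth :: "nat \<Rightarrow> nat \<Rightarrow> nat" where
  "code_nth m i = fst (prod_decode (rec_nat m (\<lambda>_ r. snd (prod_decode (r - 1))) i - 1))"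

text \<open>Recursion can only prepend, so the table grows from its last entry: stage
  \<open>j\<close> adds entry \<open>n - Suc j\<close>.\<close>

definition code_tabulate :: "nat \<Rightarrow> (nat \<Rightarrow> nat) \<Rightarrow> nat" where
  "code_tabulate n f = rec_nat 0 (\<lambda>j r. Suc (prod_encode (f (n - Suc j), r))) n"

lemma code_nth_list_encode: "i < length xs \<Longrightarrow> code_nth (list_encode xs) i = xs ! i"
proof -
  assume "i < length xs"
  moreover have "i \<le> length xs \<Longrightarrow>
    rec_nat (list_encode xs) (\<lambda>_ r. snd (prod_decode (r - 1))) i = list_encode (drop i xs)"
    by (induction i) (simp_all add: Cons_nth_drop_Suc[symmetric])
  ultimately show ?thesis
    by (simp add: code_nth_def Cons_nth_drop_Suc[symmetric])
qed

lemma code_tabulate_eq: "code_tabulate n f = list_encode (map f [0..<n])"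
proof -
  have "j \<le> n \<Longrightarrow> rec_nat 0 (\<lambda>j r. Suc (prod_encode (f (n - Suc j), r))) j =
    list_encode (map f [n - j..<n])" for j
  proof (induction j)
    case (Suc j)
    then have "[n - Suc j..<n] = (n - Suc j) # [n - j..<n]"
      by (simp add: upt_conv_Cons Suc_diff_Suc)
    with Suc show ?case by simp
  qed simp
  from this[of n] show ?thesis by (simp add: code_tabulate_def)
qed

lemma code_nth_tabulate: "i < n \<Longrightarrow> code_nth (code_tabulate n f) i = f i"
  by (simp add: code_tabulate_eq code_nth_list_encode)

lemma computable_code_nth:
  assumes "computable n f" "computable n g"
  shows "computable n (\<lambda>xs. code_nth (f xs) (g xs))"
  unfolding code_nth_def
  by (rule computable_rec_nat computable_fst_decode computable_snd_decode computable_arith_intros assms)+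

lemma computable_code_tabulate:
  assumes "computable (Suc n) (\<lambda>ys. f (hd ys) (tl ys))" "computable n g"
  shows "computable n (\<lambda>xs. code_tabulate (g xs) (\<lambda>i. f i xs))"
proof -
  have "computable (Suc (Suc n)) (\<lambda>ys. g (tl (tl ys)) - Suc (hd ys))"
    by (intro computable_diff computable_Suc computable_hd computable_tl assms)
  then have "computable (Suc (Suc n)) (\<lambda>ys. f (g (tl (tl ys)) - Suc (hd ys)) (tl (tl ys)))"
    using computable_append_args[of "[\<lambda>ys. g (tl (tl ys)) - Suc (hd ys)]" n "\<lambda>ys. f (hd ys) (tl ys)" 2]
      assms
    by (simp add: numeral_2_eq_2 drop_Suc)
  then show ?thesis
    unfolding code_tabulate_def
    by - (rule computable_rec_nat computable_prod_encode computable_arith_intros assms | assumption)+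
qed

lemmas computable_intros =
  computable_prod_encode computable_fst_decode computable_snd_decode computable_rel_set_decode
  computable_code_nth computable_code_tabulate computable_arith_intros

section \<open>Right congruences of bounded index\<close>

text \<open>
  \<open>h\<close> names the classes of a right congruence of index at most \<open>N\<close> on the words over \<open>\<Gamma>\<close> that
  saturates \<open>P\<close> on \<open>D\<close>; equivalently, a deterministic automaton with \<open>N\<close> states decides \<open>P\<close> on \<open>D\<close>.
\<close>

definition recognizes ::
    "'l set \<Rightarrow> nat \<Rightarrow> 'l list set \<Rightarrow> ('l list \<Rightarrow> bool) \<Rightarrow> ('l list \<Rightarrow> nat) \<Rightarrow> bool" where
  "recognizes \<Gamma> N D P h \<longleftrightarrow>
    (\<forall>u \<in> lists \<Gamma>. h u < N) \<and>
    (\<forall>u \<in> lists \<Gamma>. \<forall>v \<in> lists \<Gamma>. \<forall>a \<in> \<Gamma>. h u = h v \<longrightarrow> h (u @ [a]) = h (v @ [a])) \<and>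
    (\<forall>u \<in> D. \<forall>v \<in> D. h u = h v \<longrightarrow> P u = P v)"

definition recognizable :: "'l set \<Rightarrow> nat \<Rightarrow> 'l list set \<Rightarrow> ('l list \<Rightarrow> bool) \<Rightarrow> bool" where
  "recognizable \<Gamma> N D P \<longleftrightarrow> (\<exists>h. recognizes \<Gamma> N D P h)"

lemma recognizes_bound: "recognizes \<Gamma> N D P h \<Longrightarrow> u \<in> lists \<Gamma> \<Longrightarrow> h u < N"
  by (simp add: recognizes_def)

lemma recognizes_snoc:
  "recognizes \<Gamma> N D P h \<Longrightarrow> u \<in> lists \<Gamma> \<Longrightarrow> v \<in> lists \<Gamma> \<Longrightarrow> a \<in> \<Gamma> \<Longrightarrow> h u = h v \<Longrightarrow>
    h (u @ [a]) = h (v @ [a])"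
  unfolding recognizes_def by blast

lemma recognizes_iff:
  "recognizes \<Gamma> N D P h \<Longrightarrow> u \<in> D \<Longrightarrow> v \<in> D \<Longrightarrow> h u = h v \<Longrightarrow> P u = P v"
  unfolding recognizes_def by blast

text \<open>Classes may be named by pairs, sets or anything finite; an injection of \<open>Q\<close>
  into the numbers gives the numerical names that keep \<open>recognizable\<close> free of a state
  type.\<close>

lemma recognizableI:
  fixes g :: "'l list \<Rightarrow> 'q"
  assumes Q: "finite Q" "card Q \<le> N" "\<And>u. u \<in> lists \<Gamma> \<Longrightarrow> g u \<in> Q"
    and cong: "\<And>u v a. u \<in> lists \<Gamma> \<Longrightarrow> v \<in> lists \<Gamma> \<Longrightarrow> a \<in> \<Gamma> \<Longrightarrow> g u = g v \<Longrightarrow>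
      g (u @ [a]) = g (v @ [a])"
    and P: "\<And>u v. u \<in> D \<Longrightarrow> v \<in> D \<Longrightarrow> g u = g v \<Longrightarrow> P u = P v"
    and D: "D \<subseteq> lists \<Gamma>"
  shows "recognizable \<Gamma> N D P"
proof -
  obtain f :: "'q \<Rightarrow> nat" where f: "inj_on f Q" "f ` Q = {i. i < card Q}"
    using finite_imp_inj_to_nat_seg[OF Q(1)]
    by (metis card_Collect_less_nat card_image)
  have eq: "f (g u) = f (g v) \<longleftrightarrow> g u = g v" if "u \<in> lists \<Gamma>" "v \<in> lists \<Gamma>" for u v
    using f(1) Q(3) that by (auto simp: inj_on_def)
  show ?thesis
    unfolding recognizable_def recognizes_def
  proof (intro exI[of _ "f \<circ> g"] conjI ballI impI)
    fix u assume "u \<in> lists \<Gamma>"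
    then have "f (g u) \<in> f ` Q" using Q(3) by blast
    then show "(f \<circ> g) u < N" using f(2) Q(2) by simp
  next
    fix u v a assume "u \<in> lists \<Gamma>" "v \<in> lists \<Gamma>" "a \<in> \<Gamma>" "(f \<circ> g) u = (f \<circ> g) v"
    then show "(f \<circ> g) (u @ [a]) = (f \<circ> g) (v @ [a])" using cong[of u v a] eq[of u v] by simp
  next
    fix u v assume "u \<in> D" "v \<in> D" "(f \<circ> g) u = (f \<circ> g) v"
    then show "P u = P v" using P[of u v] eq[of u v] D by auto
  qed
qed

lemma recognizable_mono:
  assumes "recognizable \<Gamma> M D P" "M \<le> N"
  shows "recognizable \<Gamma> N D P"
proof -
  obtain h where h: "recognizes \<Gamma> M D P h" using assms(1) unfolding recognizable_def by blast
  have "h u < N" if "u \<in> lists \<Gamma>" for u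
    using recognizes_bound[OF h that] assms(2) by simp
  with h have "recognizes \<Gamma> N D P h" unfolding recognizes_def by blast
  then show ?thesis unfolding recognizable_def by blast
qed

lemma recognizable_cong:
  assumes "recognizable \<Gamma> N D P" "\<And>u. u \<in> D' \<Longrightarrow> u \<in> D \<and> P u = P' u"
  shows "recognizable \<Gamma> N D' P'"
proof -
  obtain h where "recognizes \<Gamma> N D P h" using assms(1) unfolding recognizable_def by blast
  then have "recognizes \<Gamma> N D' P' h" unfolding recognizes_def using assms(2) by blast
  then show ?thesis unfolding recognizable_def by blast
qed

lemma recognizable_combine:
  assumes "recognizable \<Gamma> M D P" "recognizable \<Gamma> N D Q" "D \<subseteq> lists \<Gamma>"
  shows "recognizable \<Gamma> (M * N) D (\<lambda>u. F (P u) (Q u))"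
proof -
  obtain g where rec_g: "recognizes \<Gamma> M D P g"
    using assms(1) unfolding recognizable_def by blast
  note g = recognizes_bound[OF rec_g] recognizes_snoc[OF rec_g] recognizes_iff[OF rec_g]
  obtain h where rec_h: "recognizes \<Gamma> N D Q h"
    using assms(2) unfolding recognizable_def by blast
  note h = recognizes_bound[OF rec_h] recognizes_snoc[OF rec_h] recognizes_iff[OF rec_h]
  show ?thesis
  proof (rule recognizableI[where g = "\<lambda>u. (g u, h u)" and Q = "{..<M} \<times> {..<N}"])
    fix u v assume "u \<in> D" "v \<in> D" "(g u, h u) = (g v, h v)"
    with g(3)[of u v] h(3)[of u v] show "F (P u) (Q u) = F (P v) (Q v)" by simp
  next
    fix u v a assume "u \<in> lists \<Gamma>" "v \<in> lists \<Gamma>" "a \<in> \<Gamma>" "(g u, h u) = (g v, h v)"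
    with g(2)[of u v a] h(2)[of u v a] show "(g (u @ [a]), h (u @ [a])) = (g (v @ [a]), h (v @ [a]))"
      by simp
  qed (use g(1) h(1) assms(3) in \<open>auto simp: card_cartesian_product\<close>)
qed

text \<open>Serves the case that \<open>P\<close> is under control only on words with
  \<open>C\<close>, where \<open>recognizable_combine\<close> does not apply. Words without
  \<open>C\<close> are settled by the first component.\<close>

lemma recognizable_guard:
  assumes "recognizable \<Gamma> M D C" "recognizable \<Gamma> N {u \<in> D. C u} P" "D \<subseteq> lists \<Gamma>"
  shows "recognizable \<Gamma> (M * N) D (\<lambda>u. C u \<and> P u)"
proof -
  obtain g where rec_g: "recognizes \<Gamma> M D C g"
    using assms(1) unfolding recognizable_def by blast
  note g = recognizes_bound[OF rec_g] recognizes_snoc[OF rec_g] recognizes_iff[OF rec_g]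
  obtain h where rec_h: "recognizes \<Gamma> N {u \<in> D. C u} P h"
    using assms(2) unfolding recognizable_def by blast
  note h = recognizes_bound[OF rec_h] recognizes_snoc[OF rec_h] recognizes_iff[OF rec_h]
  show ?thesis
  proof (rule recognizableI[where g = "\<lambda>u. (g u, h u)" and Q = "{..<M} \<times> {..<N}"])
    fix u v assume "u \<in> D" "v \<in> D" "(g u, h u) = (g v, h v)"
    with g(3)[of u v] h(3)[of u v] show "(C u \<and> P u) = (C v \<and> P v)" by auto
  next
    fix u v a assume "u \<in> lists \<Gamma>" "v \<in> lists \<Gamma>" "a \<in> \<Gamma>" "(g u, h u) = (g v, h v)"
    with g(2)[of u v a] h(2)[of u v a] show "(g (u @ [a]), h (u @ [a])) = (g (v @ [a]), h (v @ [a]))"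
      by simp
  qed (use g(1) h(1) assms(3) in \<open>auto simp: card_cartesian_product\<close>)
qed

text \<open>Subset construction: a word is classified by the set of classes of its
  \<open>r\<close>-variants. The variants range over all of \<open>lists \<Gamma>\<close>, because a
  prefix of a word in \<open>D\<close> may lie outside \<open>D\<close>; the closure condition
  brings them back into \<open>D\<close> where \<open>P\<close> is consulted.\<close>

lemma recognizable_project:
  assumes "recognizable \<Gamma> N D P" "D \<subseteq> lists \<Gamma>"
    and D: "\<And>u v. u \<in> D \<Longrightarrow> v \<in> lists \<Gamma> \<Longrightarrow> list_all2 r u v \<Longrightarrow> v \<in> D"
  shows "recognizable \<Gamma> (2 ^ N) D (\<lambda>u. \<exists>v \<in> D. list_all2 r u v \<and> P v)"
proof -
  obtain h where rec_h: "recognizes \<Gamma> N D P h"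
    using assms(1) unfolding recognizable_def by blast
  note h = recognizes_bound[OF rec_h] recognizes_snoc[OF rec_h] recognizes_iff[OF rec_h]
  let ?g = "\<lambda>u. h ` {v \<in> lists \<Gamma>. list_all2 r u v}"
  have step: "?g (u @ [a]) \<subseteq> ?g (v @ [a])"
    if "u \<in> lists \<Gamma>" "v \<in> lists \<Gamma>" "?g u = ?g v" for u v a
  proof
    fix q assume "q \<in> ?g (u @ [a])"
    then obtain x where x: "x \<in> lists \<Gamma>" "list_all2 r (u @ [a]) x" "q = h x" by blast
    then obtain w b where "x = w @ [b]" "list_all2 r u w" "r a b"
      by (auto simp: list_all2_append1 list_all2_Cons1)
    with x have w: "w \<in> lists \<Gamma>" "b \<in> \<Gamma>" "list_all2 r u w" "r a b" "q = h (w @ [b])" by auto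
    then have "h w \<in> ?g v" using that(3) by blast
    then obtain w' where w': "w' \<in> lists \<Gamma>" "list_all2 r v w'" "h w = h w'" by auto
    then have "q = h (w' @ [b])" using h(2)[of w w' b] w by simp
    moreover have "list_all2 r (v @ [a]) (w' @ [b])" using w w' by (simp add: list_all2_appendI)
    ultimately show "q \<in> ?g (v @ [a])" using w w' by auto
  qed
  have P: "\<exists>w \<in> D. list_all2 r v w \<and> P w"
    if uv: "u \<in> D" "v \<in> D" "?g u = ?g v" "\<exists>w \<in> D. list_all2 r u w \<and> P w" for u v
  proof -
    obtain w where w: "w \<in> D" "list_all2 r u w" "P w" using uv(4) by blast
    then have "h w \<in> ?g v" using assms(2) uv(3) by blast
    then obtain w' where w': "w' \<in> lists \<Gamma>" "list_all2 r v w'" "h w = h w'" by auto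
    then have "w' \<in> D" using D uv(2) by blast
    with w w' h(3)[of w w'] show ?thesis by blast
  qed
  show ?thesis
  proof (rule recognizableI[where g = ?g and Q = "Pow {..<N}"])
    fix u v a assume "u \<in> lists \<Gamma>" "v \<in> lists \<Gamma>" "?g u = ?g v"
    then show "?g (u @ [a]) = ?g (v @ [a])" using step[of u v a] step[of v u a] by simp
  next
    fix u v assume "u \<in> D" "v \<in> D" "?g u = ?g v"
    then show "(\<exists>w \<in> D. list_all2 r u w \<and> P w) = (\<exists>w \<in> D. list_all2 r v w \<and> P w)"
      using P[of u v] P[of v u] by metis
  qed (use h(1) assms(2) in \<open>auto simp: card_Pow\<close>)
qed

lemma recognizable_map:
  assumes "recognizable \<Gamma> N D P" "\<And>a. a \<in> \<Delta> \<Longrightarrow> f a \<in> \<Gamma>" "\<And>u. u \<in> E \<Longrightarrow> map f u \<in> D"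
  shows "recognizable \<Delta> N E (\<lambda>u. P (map f u))"
proof -
  have *: "map f u \<in> lists \<Gamma>" if "u \<in> lists \<Delta>" for u using that assms(2) by auto
  obtain h where rec_h: "recognizes \<Gamma> N D P h"
    using assms(1) unfolding recognizable_def by blast
  note h = recognizes_bound[OF rec_h] recognizes_snoc[OF rec_h] recognizes_iff[OF rec_h]
  show ?thesis
    unfolding recognizable_def recognizes_def
  proof (intro exI[of _ "\<lambda>u. h (map f u)"] conjI ballI impI)
    fix u assume "u \<in> lists \<Delta>"
    then show "h (map f u) < N" using h(1) * by blast
  next
    fix u v a assume "u \<in> lists \<Delta>" "v \<in> lists \<Delta>" "a \<in> \<Delta>" "h (map f u) = h (map f v)"
    then show "h (map f (u @ [a])) = h (map f (v @ [a]))"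
      using h(2)[of "map f u" "map f v" "f a"] * assms(2) by simp
  next
    fix u v assume "u \<in> E" "v \<in> E" "h (map f u) = h (map f v)"
    then show "P (map f u) = P (map f v)" using h(3) assms(3) by blast
  qed
qed

text \<open>In a shortest witness no two prefixes are equivalent: deleting the segment between them
  would keep the class and therefore \<open>P\<close>. So its \<open>length v + 1\<close> prefixes
  need distinct classes.\<close>

lemma recognizable_short_witness:
  assumes "recognizable \<Gamma> N (lists \<Gamma>) P" "u \<in> lists \<Gamma>" "P u"
  obtains v where "v \<in> lists \<Gamma>" "P v" "length v < N"
proof -
  obtain h where rec_h: "recognizes \<Gamma> N (lists \<Gamma>) P h"
    using assms(1) unfolding recognizable_def by blast
  note h = recognizes_bound[OF rec_h] recognizes_snoc[OF rec_h] recognizes_iff[OF rec_h]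
  have h_append: "h (u @ w) = h (v @ w)"
    if "u \<in> lists \<Gamma>" "v \<in> lists \<Gamma>" "w \<in> lists \<Gamma>" "h u = h v" for u v w
    using that(3)
  proof (induction w rule: rev_induct)
    case (snoc a w)
    then show ?case using h(2)[of "u @ w" "v @ w" a] that by simp
  qed (use that in simp)
  obtain v where v: "v \<in> lists \<Gamma> \<and> P v" and min: "\<And>w. w \<in> lists \<Gamma> \<and> P w \<Longrightarrow> length v \<le> length w"
    using ex_has_least_nat[of "\<lambda>v. v \<in> lists \<Gamma> \<and> P v" u length] assms by blast
  have sub: "take i v \<in> lists \<Gamma>" "drop i v \<in> lists \<Gamma>" for i
    using v by (auto dest: in_set_takeD in_set_dropD)
  have "length v < N"
  proof (rule ccontr)
    assume "\<not> length v < N"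
    then have "card ((\<lambda>i. h (take i v)) ` {..length v}) < card {..length v}"
      using card_mono[of "{..<N}" "(\<lambda>i. h (take i v)) ` {..length v}"] h(1) sub by force
    then obtain i j where "i \<le> length v" "j \<le> length v" "i \<noteq> j" "h (take i v) = h (take j v)"
      using pigeonhole[of "\<lambda>i. h (take i v)" "{..length v}"] by (auto simp: inj_on_def)
    then obtain i j where ij: "i < j" "j \<le> length v" "h (take i v) = h (take j v)"
      by (metis linorder_neqE_nat)
    let ?w = "take i v @ drop j v"
    have "h ?w = h (take j v @ drop j v)" using h_append ij sub by blast
    then have "P ?w" using h(3)[of ?w v] v sub by simp
    moreover have "?w \<in> lists \<Gamma>" using sub by simp
    ultimately show False using min[of ?w] ij by simp
  qed
  with v show ?thesis using that by blast
qed

section \<open>Satisfaction on transition sequences\<close>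

type_synonym ('s, 'r, 'a) transition = "'s \<times> ('a \<times> 'r reg_op) \<times> 's"

fun reg_of :: "'r reg_op \<Rightarrow> 'r" where
  "reg_of (Fresh r) = r"
| "reg_of (Reuse r) = r"

definition tlabel :: "('s, 'r, 'a) transition \<Rightarrow> 'a" where
  "tlabel t = fst (fst (snd t))"

definition taction :: "('s, 'r, 'a) transition \<Rightarrow> 'r reg_op" where
  "taction t = snd (fst (snd t))"

definition treg :: "('s, 'r, 'a) transition \<Rightarrow> 'r" where
  "treg t = reg_of (taction t)"

text \<open>
  Along a run with transition sequence \<open>u\<close>, positions \<open>i\<close> and \<open>j\<close> carry the same data value iff
  they access the same register and that register is not refreshed in between.
\<close>

definition same_session :: "('s, 'r, 'a) transition list \<Rightarrow> nat \<Rightarrow> nat \<Rightarrow> bool" where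
  "same_session u i j \<longleftrightarrow> treg (u ! i) = treg (u ! j) \<and>
    (\<forall>k. min i j < k \<and> k \<le> max i j \<longrightarrow> taction (u ! k) \<noteq> Fresh (treg (u ! i)))"

primrec ssat :: "('s, 'r, 'a) transition list \<Rightarrow> (nat \<Rightarrow> nat) \<Rightarrow> (nat \<Rightarrow> nat set) \<Rightarrow> 'a dmso \<Rightarrow> bool"
  where
  "ssat u \<sigma> \<rho> (Label x a) \<longleftrightarrow> tlabel (u ! \<sigma> x) = a"
| "ssat u \<sigma> \<rho> (Eq x y) \<longleftrightarrow> \<sigma> x = \<sigma> y"
| "ssat u \<sigma> \<rho> (Succ x y) \<longleftrightarrow> \<sigma> y = \<sigma> x + 1"
| "ssat u \<sigma> \<rho> (Sim x y) \<longleftrightarrow> same_session u (\<sigma> x) (\<sigma> y)"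
| "ssat u \<sigma> \<rho> (Mem x X) \<longleftrightarrow> \<sigma> x \<in> \<rho> X"
| "ssat u \<sigma> \<rho> (Neg \<phi>) \<longleftrightarrow> \<not> ssat u \<sigma> \<rho> \<phi>"
| "ssat u \<sigma> \<rho> (Or \<phi> \<psi>) \<longleftrightarrow> ssat u \<sigma> \<rho> \<phi> \<or> ssat u \<sigma> \<rho> \<psi>"
| "ssat u \<sigma> \<rho> (Ex1 x \<phi>) \<longleftrightarrow> (\<exists>i < length u. ssat u (\<sigma>(x := i)) \<rho> \<phi>)"
| "ssat u \<sigma> \<rho> (Ex2 X \<phi>) \<longleftrightarrow> (\<exists>M \<subseteq> {..<length u}. ssat u \<sigma> (\<rho>(X := M)) \<phi>)"

lemma ssat_cong:
  assumes "\<And>x. x \<in> free1 \<phi> \<Longrightarrow> \<sigma> x = \<sigma>' x" and "\<And>X. X \<in> free2 \<phi> \<Longrightarrow> \<rho> X = \<rho>' X"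
  shows "ssat u \<sigma> \<rho> \<phi> \<longleftrightarrow> ssat u \<sigma>' \<rho>' \<phi>"
  using assms
proof (induction \<phi> arbitrary: \<sigma> \<sigma>' \<rho> \<rho>')
  case (Neg \<phi>)
  have "ssat u \<sigma> \<rho> \<phi> \<longleftrightarrow> ssat u \<sigma>' \<rho>' \<phi>" by (rule Neg.IH) (use Neg.prems in auto)
  then show ?case by simp
next
  case (Or \<phi> \<psi>)
  have "ssat u \<sigma> \<rho> \<phi> \<longleftrightarrow> ssat u \<sigma>' \<rho>' \<phi>" by (rule Or.IH(1)) (use Or.prems in auto)
  moreover have "ssat u \<sigma> \<rho> \<psi> \<longleftrightarrow> ssat u \<sigma>' \<rho>' \<psi>" by (rule Or.IH(2)) (use Or.prems in auto)
  ultimately show ?case by simp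
next
  case (Ex1 x \<phi>)
  have "ssat u (\<sigma>(x := i)) \<rho> \<phi> \<longleftrightarrow> ssat u (\<sigma>'(x := i)) \<rho>' \<phi>" for i
    by (rule Ex1.IH) (use Ex1.prems in auto)
  then show ?case by simp
next
  case (Ex2 X \<phi>)
  have "ssat u \<sigma> (\<rho>(X := M)) \<phi> \<longleftrightarrow> ssat u \<sigma>' (\<rho>'(X := M)) \<phi>" for M
    by (rule Ex2.IH) (use Ex2.prems in auto)
  then show ?case by simp
qed auto

text \<open>
  Valuations are written into the word: \<open>Inl x\<close> marks the position of the first-order variable \<open>x\<close>,
  \<open>Inr X\<close> the members of the second-order variable \<open>X\<close>.
\<close>

type_synonym ('s, 'r, 'a) mword = "(('s, 'r, 'a) transition \<times> (nat + nat) set) list"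

definition fo_val :: "('s, 'r, 'a) mword \<Rightarrow> nat \<Rightarrow> nat" where
  "fo_val v x = (THE i. i < length v \<and> Inl x \<in> snd (v ! i))"

definition so_val :: "('s, 'r, 'a) mword \<Rightarrow> nat \<Rightarrow> nat set" where
  "so_val v X = {i. i < length v \<and> Inr X \<in> snd (v ! i)}"

definition msat :: "'a dmso \<Rightarrow> ('s, 'r, 'a) mword \<Rightarrow> bool" where
  "msat \<phi> v \<longleftrightarrow> ssat (map fst v) (fo_val v) (so_val v) \<phi>"

definition marked_once :: "nat \<Rightarrow> ('s, 'r, 'a) mword \<Rightarrow> bool" where
  "marked_once x v \<longleftrightarrow> (\<exists>!i. i < length v \<and> Inl x \<in> snd (v ! i))"

text \<open>Marks are arbitrary sets of variables, which makes the alphabet infinite as soon as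
  \<open>T\<close> is nonempty. This is harmless: only the number of classes is bounded, never the
  number of letters.\<close>

definition valid_words :: "('s, 'r, 'a) transition set \<Rightarrow> nat set \<Rightarrow> ('s, 'r, 'a) mword set" where
  "valid_words T V = {v \<in> lists (T \<times> UNIV). \<forall>x \<in> V. marked_once x v}"

lemma valid_words_lists: "valid_words T V \<subseteq> lists (T \<times> UNIV)"
  by (auto simp: valid_words_def)

lemma fo_val_iff:
  assumes "marked_once x v" "i < length v"
  shows "Inl x \<in> snd (v ! i) \<longleftrightarrow> i = fo_val v x"
  using assms theI'[of "\<lambda>i. i < length v \<and> Inl x \<in> snd (v ! i)"]
  unfolding marked_once_def fo_val_def by blast

lemma fo_val_less: "marked_once x v \<Longrightarrow> fo_val v x < length v"
  using theI'[of "\<lambda>i. i < length v \<and> Inl x \<in> snd (v ! i)"]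
  unfolding marked_once_def fo_val_def by blast

section \<open>Congruences for marks and atomic formulas\<close>

lemma marked_once_iff_card:
  "marked_once x v \<longleftrightarrow> length (filter (\<lambda>l. Inl x \<in> snd l) v) = 1"
proof -
  have "(\<exists>!i. p i) \<longleftrightarrow> (\<exists>i. \<forall>j. p j = (j = i))" for p :: "nat \<Rightarrow> bool"
    by (metis (full_types))
  then show ?thesis
    by (simp add: marked_once_def length_filter_conv_card card_1_singleton_iff set_eq_iff)
qed

text \<open>Three classes: no mark, one, several. Unlike unique existence, a count capped at 2 can
  be updated letter by letter.\<close>

lemma recognizable_marked_once:
  fixes D :: "('s, 'r, 'a) mword set"
  assumes "D \<subseteq> lists \<Gamma>"
  shows "recognizable \<Gamma> 3 D (marked_once x)"
proof -
  let ?g = "\<lambda>v :: ('s, 'r, 'a) mword. min 2 (length (filter (\<lambda>l. Inl x \<in> snd l) v))"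
  have snoc: "?g (v @ [a]) = min 2 (?g v + of_bool (Inl x \<in> snd a))" for v a
    by (simp add: min_def)
  have once: "marked_once x v \<longleftrightarrow> ?g v = 1" for v :: "('s, 'r, 'a) mword"
    by (auto simp: marked_once_iff_card min_def)
  have "?g v \<in> {..<3}" for v by (simp add: min_def)
  then show ?thesis
    by (intro recognizableI[where g = ?g and Q = "{..<3}"])
      (simp_all only: snoc once assms finite_lessThan card_lessThan order_refl)
qed

lemma recognizable_exists_letter:
  assumes "D \<subseteq> lists \<Gamma>"
  shows "recognizable \<Gamma> 2 D (\<lambda>v. \<exists>l \<in> set v. p l)"
  by (rule recognizableI[where g = "\<lambda>v. \<exists>l \<in> set v. p l" and Q = UNIV]) (use assms in auto)

text \<open>Four classes: whether a pair has been found, and whether the last letter satisfies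
  \<open>p\<close> and may start one.\<close>

lemma recognizable_exists_adjacent:
  assumes "D \<subseteq> lists \<Gamma>"
  shows "recognizable \<Gamma> 4 D (\<lambda>v. \<exists>i. Suc i < length v \<and> p (v ! i) \<and> q (v ! Suc i))"
proof -
  define ends where "ends v \<longleftrightarrow> v \<noteq> [] \<and> p (last v)" for v
  let ?found = "\<lambda>v. \<exists>i. Suc i < length v \<and> p (v ! i) \<and> q (v ! Suc i)"
  have found_snoc: "?found (v @ [a]) \<longleftrightarrow> ?found v \<or> ends v \<and> q a" for v a
  proof
    assume "?found (v @ [a])"
    then obtain i where i: "Suc i < length (v @ [a])" "p ((v @ [a]) ! i)" "q ((v @ [a]) ! Suc i)" by blast
    show "?found v \<or> ends v \<and> q a"
    proof (cases "Suc i < length v")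
      case True
      with i show ?thesis by (auto simp: nth_append)
    next
      case False
      with i have "length v = Suc i" by simp
      moreover from this have "last v = v ! i" by (subst last_conv_nth) auto
      ultimately show ?thesis using i by (auto simp: ends_def nth_append)
    qed
  next
    assume "?found v \<or> ends v \<and> q a"
    then show "?found (v @ [a])"
    proof
      assume "?found v"
      then obtain i where "Suc i < length v" "p (v ! i)" "q (v ! Suc i)" by blast
      then show ?thesis by (intro exI[of _ i]) (auto simp: nth_append)
    next
      assume "ends v \<and> q a"
      then show ?thesis
        by (intro exI[of _ "length v - 1"]) (auto simp: ends_def nth_append last_conv_nth)
    qed
  qed
  define found where "found v \<longleftrightarrow> ?found v" for v
  note found_snoc = found_snoc[folded found_def]
  have "recognizable \<Gamma> 4 D found"
    by (rule recognizableI[where g = "\<lambda>v. (found v, ends v)" and Q = "UNIV \<times> UNIV"])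
      (use assms in \<open>auto simp: found_snoc ends_def card_cartesian_product simp del: UNIV_Times_UNIV\<close>)
  then show ?thesis unfolding found_def .
qed

text \<open>
  Reading a word, it suffices to remember the set of registers that still hold a value read at a
  position satisfying \<open>p\<close>.
\<close>

lemma recognizable_session_pair:
  fixes p q :: "('s, 'r, 'a) transition \<times> 'm \<Rightarrow> bool"
  assumes "finite R" "\<And>l. l \<in> \<Gamma> \<Longrightarrow> treg (fst l) \<in> R" "D \<subseteq> lists \<Gamma>"
  shows "recognizable \<Gamma> (2 * 2 ^ card R) D (\<lambda>v. \<exists>j < length v. \<exists>i \<le> j. p (v ! i) \<and> q (v ! j) \<and>
    same_session (map fst v) i j)"
proof -
  let ?active = "\<lambda>v. {r. \<exists>i < length v. p (v ! i) \<and> treg (fst (v ! i)) = r \<and>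
    (\<forall>k < length v. i < k \<longrightarrow> taction (fst (v ! k)) \<noteq> Fresh r)}"
  let ?found = "\<lambda>v. \<exists>j < length v. \<exists>i \<le> j. p (v ! i) \<and> q (v ! j) \<and>
    same_session (map fst v) i j"
  \<comment> \<open>A refresh of \<open>r\<close> ends the older session before the new position may
    open its own; only later positions are inspected, so its own \<open>Fresh\<close> does no
    harm.\<close>
  have active_snoc: "?active (v @ [a]) =
    {r \<in> ?active v. taction (fst a) \<noteq> Fresh r} \<union> {r. p a \<and> treg (fst a) = r}" for v a
    by (rule set_eqI) (simp add: Ex_less_Suc All_less_Suc nth_append cong: conj_cong, blast)
  have session: "same_session (map fst v) i j \<longleftrightarrow> treg (fst (v ! i)) = treg (fst (v ! j)) \<and>
     (\<forall>k. i < k \<and> k \<le> j \<longrightarrow> taction (fst (v ! k)) \<noteq> Fresh (treg (fst (v ! i))))"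
    if "i \<le> j" "j < length v" for v :: "(('s, 'r, 'a) transition \<times> 'm) list" and i j
    using that by (auto simp: same_session_def)
  \<comment> \<open>The test uses the active registers after reading \<open>a\<close>, which covers
    the pair \<open>i = j\<close>.\<close>
  have found_snoc: "?found (v @ [a]) \<longleftrightarrow> ?found v \<or> q a \<and> treg (fst a) \<in> ?active (v @ [a])" for v a
  proof -
    have "same_session (map fst (v @ [a])) i j \<longleftrightarrow> same_session (map fst v) i j"
      if "i \<le> j" "j < length v" for i j
      using that by (auto simp: same_session_def nth_append)
    then have "?found (v @ [a]) \<longleftrightarrow> (\<exists>i \<le> length v. p ((v @ [a]) ! i) \<and> q a \<and>
      same_session (map fst (v @ [a])) i (length v)) \<or> ?found v"
      by (simp add: Ex_less_Suc nth_append cong: conj_cong)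
    moreover have "(\<exists>i \<le> length v. p ((v @ [a]) ! i) \<and> q a \<and>
      same_session (map fst (v @ [a])) i (length v)) \<longleftrightarrow> q a \<and> treg (fst a) \<in> ?active (v @ [a])"
    proof -
      have "same_session (map fst (v @ [a])) i (length v) \<longleftrightarrow> treg (fst ((v @ [a]) ! i)) = treg (fst a) \<and>
        (\<forall>k < length (v @ [a]). i < k \<longrightarrow> taction (fst ((v @ [a]) ! k)) \<noteq> Fresh (treg (fst a)))"
        if "i \<le> length v" for i
        using session[of i "length v" "v @ [a]"] that
        by (auto simp: less_Suc_eq_le nth_append_length simp del: map_append)
      then show ?thesis by (auto simp: less_Suc_eq_le simp del: map_append)
    qed
    ultimately show ?thesis by blast
  qed
  define active where "active v = ?active v" for v
  define found where "found v \<longleftrightarrow> ?found v" for v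
  note snoc = active_snoc[folded active_def] found_snoc[folded active_def found_def]
  have "recognizable \<Gamma> (2 * 2 ^ card R) D found"
  proof (rule recognizableI[where g = "\<lambda>v. (found v, active v)" and Q = "UNIV \<times> Pow R"])
    show "finite ((UNIV :: bool set) \<times> Pow R)" "card ((UNIV :: bool set) \<times> Pow R) \<le> 2 * 2 ^ card R"
      using assms(1) by (auto simp: card_cartesian_product card_Pow)
  next
    fix u assume "u \<in> lists \<Gamma>"
    then have "treg (fst (u ! i)) \<in> R" if "i < length u" for i using that assms(2)[of "u ! i"] by auto
    then show "(found u, active u) \<in> UNIV \<times> Pow R" by (auto simp: active_def)
  next
    fix u v a assume "(found u, active u) = (found v, active v)"
    then show "(found (u @ [a]), active (u @ [a])) = (found (v @ [a]), active (v @ [a]))"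
      by (simp add: snoc)
  qed (use assms in auto)
  then show ?thesis unfolding found_def .
qed

lemma same_session_sym: "same_session u i j \<longleftrightarrow> same_session u j i"
  by (auto simp: same_session_def min.commute max.commute)

section \<open>Existential quantification as projection of one mark\<close>

definition agree_off :: "nat + nat \<Rightarrow> ('s, 'r, 'a) mword \<Rightarrow> ('s, 'r, 'a) mword \<Rightarrow> bool" where
  "agree_off z = list_all2 (\<lambda>a b. fst a = fst b \<and> snd a - {z} = snd b - {z})"

definition remark :: "nat + nat \<Rightarrow> nat set \<Rightarrow> ('s, 'r, 'a) mword \<Rightarrow> ('s, 'r, 'a) mword" where
  "remark z M v =
    map (\<lambda>i. (fst (v ! i), if i \<in> M then insert z (snd (v ! i)) else snd (v ! i) - {z})) [0..<length v]"

lemma agree_off_mark: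
  assumes "agree_off z u v" "y \<noteq> z"
  shows "i < length u \<and> y \<in> snd (u ! i) \<longleftrightarrow> i < length v \<and> y \<in> snd (v ! i)"
proof -
  have "length u = length v" using assms(1) by (auto simp: agree_off_def dest: list_all2_lengthD)
  moreover have "y \<in> snd (u ! i) - {z} \<longleftrightarrow> y \<in> snd (v ! i) - {z}" if "i < length u"
    using list_all2_nthD[OF assms(1)[unfolded agree_off_def] that] by simp
  ultimately show ?thesis using assms(2) by auto
qed

lemma agree_off_map_fst: "agree_off z u v \<Longrightarrow> map fst v = map fst u"
  by (auto simp: agree_off_def list_all2_conv_all_nth list_eq_iff_nth_eq)

lemma agree_off_marked_once: "agree_off z u v \<Longrightarrow> Inl y \<noteq> z \<Longrightarrow> marked_once y v = marked_once y u"
  unfolding marked_once_def by (simp add: agree_off_mark)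

lemma agree_off_fo_val: "agree_off z u v \<Longrightarrow> Inl y \<noteq> z \<Longrightarrow> fo_val v y = fo_val u y"
  unfolding fo_val_def by (simp add: agree_off_mark)

lemma agree_off_so_val: "agree_off z u v \<Longrightarrow> Inr Y \<noteq> z \<Longrightarrow> so_val v Y = so_val u Y"
  unfolding so_val_def by (simp add: agree_off_mark)

text \<open>Supplies the closure condition of \<open>recognizable_project\<close>: marks other than
  \<open>z\<close> stay in place, and those of \<open>V\<close> are among them.\<close>

lemma agree_off_valid_words:
  assumes "agree_off z u v" "u \<in> valid_words T V" "z \<notin> Inl ` V" "v \<in> lists (T \<times> UNIV)"
  shows "v \<in> valid_words T V"
proof -
  have "marked_once x v" if "x \<in> V" for x
    using agree_off_marked_once[OF assms(1), of x] assms(2,3) that by (auto simp: valid_words_def)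
  then show ?thesis using assms(4) by (simp add: valid_words_def)
qed

lemma agree_off_remark: "agree_off z v (remark z M v)"
  by (auto simp: agree_off_def remark_def list_all2_conv_all_nth)

lemma remark_mark:
  "i < length (remark z M v) \<and> z \<in> snd (remark z M v ! i) \<longleftrightarrow> i < length v \<and> i \<in> M"
  by (auto simp: remark_def split: if_splits)

lemma remark_in_lists:
  assumes "v \<in> lists (T \<times> UNIV)"
  shows "remark z M v \<in> lists (T \<times> UNIV)"
proof -
  have "fst (v ! i) \<in> T" if "i < length v" for i
    using assms nth_mem[OF that] by (auto simp: mem_Times_iff)
  then show ?thesis by (auto simp: remark_def)
qed

text \<open>A value for \<open>x\<close> is a new choice of the marks \<open>Inl x\<close>. In
  \<open>u\<close> these marks are arbitrary, which is why \<open>x\<close> is removed from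
  \<open>V\<close>; the variant must carry exactly one, so \<open>marked_once\<close> enters as a
  guard.\<close>

lemma msat_Ex1_iff:
  assumes "u \<in> valid_words T (V - {x})"
  shows "msat (Ex1 x \<phi>) u \<longleftrightarrow>
    (\<exists>v \<in> valid_words T (V - {x}). agree_off (Inl x) u v \<and> marked_once x v \<and> msat \<phi> v)"
proof
  assume "msat (Ex1 x \<phi>) u"
  then obtain i where i: "i < length u" "ssat (map fst u) ((fo_val u)(x := i)) (so_val u) \<phi>"
    by (auto simp: msat_def)
  let ?v = "remark (Inl x) {i} u"
  have agree: "agree_off (Inl x) u ?v" by (rule agree_off_remark)
  have mark: "(\<lambda>j. j < length ?v \<and> Inl x \<in> snd (?v ! j)) = (\<lambda>j. j = i)"
    using i(1) by (auto simp: remark_mark fun_eq_iff)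
  have "?v \<in> valid_words T (V - {x})"
    using agree_off_valid_words[OF agree assms] remark_in_lists subsetD[OF valid_words_lists assms]
    by blast
  moreover have "marked_once x ?v" unfolding marked_once_def mark by simp
  moreover have "fo_val ?v x = i" unfolding fo_val_def mark by simp
  then have "fo_val ?v = (fo_val u)(x := i)"
    using agree_off_fo_val[OF agree] by (auto simp: fun_eq_iff)
  then have "msat \<phi> ?v"
    using i(2) agree_off_map_fst[OF agree] agree_off_so_val[OF agree] unfolding msat_def
    by (metis (no_types, lifting) ext sum.distinct(1))
  ultimately show "\<exists>v \<in> valid_words T (V - {x}). agree_off (Inl x) u v \<and> marked_once x v \<and> msat \<phi> v"
    using agree by blast
next
  assume "\<exists>v \<in> valid_words T (V - {x}). agree_off (Inl x) u v \<and> marked_once x v \<and> msat \<phi> v"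
  then obtain v where v: "agree_off (Inl x) u v" "marked_once x v" "msat \<phi> v" by blast
  have "fo_val v = (fo_val u)(x := fo_val v x)" "so_val v = so_val u"
    using agree_off_fo_val[OF v(1)] agree_off_so_val[OF v(1)] by (auto simp: fun_eq_iff)
  with v(3) have "ssat (map fst u) ((fo_val u)(x := fo_val v x)) (so_val u) \<phi>"
    using agree_off_map_fst[OF v(1)] unfolding msat_def by metis
  moreover have "fo_val v x < length u"
    using fo_val_less[OF v(2)] agree_off_map_fst[OF v(1)] by (metis length_map)
  ultimately show "msat (Ex1 x \<phi>) u" by (auto simp: msat_def)
qed

text \<open>Unlike for positions, every choice of the marks \<open>Inr X\<close> denotes a
  legitimate value.\<close>

lemma msat_Ex2_iff:
  assumes "u \<in> valid_words T V"
  shows "msat (Ex2 X \<phi>) u \<longleftrightarrow> (\<exists>v \<in> valid_words T V. agree_off (Inr X) u v \<and> msat \<phi> v)"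
proof
  assume "msat (Ex2 X \<phi>) u"
  then obtain M where M: "M \<subseteq> {..<length u}" "ssat (map fst u) (fo_val u) ((so_val u)(X := M)) \<phi>"
    by (auto simp: msat_def)
  let ?v = "remark (Inr X) M u"
  have agree: "agree_off (Inr X) u ?v" by (rule agree_off_remark)
  have "?v \<in> valid_words T V"
    using agree_off_valid_words[OF agree assms] remark_in_lists subsetD[OF valid_words_lists assms]
    by blast
  moreover have "so_val ?v X = M"
    using M(1) unfolding so_val_def remark_mark by auto
  then have "so_val ?v = (so_val u)(X := M)" "fo_val ?v = fo_val u"
    using agree_off_so_val[OF agree] agree_off_fo_val[OF agree] by (auto simp: fun_eq_iff)
  then have "msat \<phi> ?v"
    using M(2) agree_off_map_fst[OF agree] unfolding msat_def by metis
  ultimately show "\<exists>v \<in> valid_words T V. agree_off (Inr X) u v \<and> msat \<phi> v"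
    using agree by blast
next
  assume "\<exists>v \<in> valid_words T V. agree_off (Inr X) u v \<and> msat \<phi> v"
  then obtain v where v: "agree_off (Inr X) u v" "msat \<phi> v" by blast
  have "so_val v = (so_val u)(X := so_val v X)" "fo_val v = fo_val u"
    using agree_off_fo_val[OF v(1)] agree_off_so_val[OF v(1)] by (auto simp: fun_eq_iff)
  with v(2) have "ssat (map fst u) (fo_val u) ((so_val u)(X := so_val v X)) \<phi>"
    using agree_off_map_fst[OF v(1)] unfolding msat_def by metis
  moreover have "so_val v X \<subseteq> {..<length u}"
    using agree_off_map_fst[OF v(1)] by (auto simp: so_val_def) (metis length_map)
  ultimately show "msat (Ex2 X \<phi>) u" by (auto simp: msat_def)
qed

text \<open>The base \<open>4 ^ Suc K\<close> is the square of \<open>2 * 2 ^ K\<close>, the cost of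
  \<open>Sim\<close> with its two orders of positions, and covers the other atoms. The step
  \<open>8 ^ t = 2 ^ (3 * t)\<close> is the cost of a first-order quantifier: three classes of the
  guard, then subsets. It also dominates the product for \<open>Or\<close>.\<close>

definition tower :: "nat \<Rightarrow> nat \<Rightarrow> nat" where
  "tower K k = rec_nat (4 ^ Suc K) (\<lambda>_ t. 8 ^ t) k"

lemma tower_Suc: "tower K (Suc k) = 8 ^ tower K k"
  by (simp add: tower_def)

lemma tower_mono: "i \<le> j \<Longrightarrow> tower K i \<le> tower K j"
proof (rule lift_Suc_mono_le[of "tower K"])
  fix k
  have "t \<le> 8 ^ t" for t :: nat
    using less_exp[of t] power_mono[of "2 :: nat" 8 t] by simp
  then show "tower K k \<le> tower K (Suc k)" by (simp add: tower_Suc)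
qed

lemma tower_ge: "4 ^ Suc K \<le> tower K k"
  using tower_mono[of 0 k K] by (simp add: tower_def)

section \<open>Number of classes needed for a formula\<close>

lemma list_encode_greater: "x \<in> set xs \<Longrightarrow> x < list_encode xs"
proof (induction xs)
  case (Cons y ys)
  then show ?case
    using le_prod_encode_1[of y "list_encode ys"] le_prod_encode_2[of "list_encode ys" y]
    by (auto simp: less_Suc_eq_le intro: order.trans[OF less_imp_le])
qed simp

text \<open>Lets the code itself measure formulas: as height of the tower and as number of table
  rounds in the evaluation.\<close>

lemma dmso_code_less:
  "dmso_code e \<phi> < dmso_code e (Neg \<phi>)"
  "dmso_code e \<phi> < dmso_code e (Or \<phi> \<psi>)" "dmso_code e \<psi> < dmso_code e (Or \<phi> \<psi>)"
  "dmso_code e \<phi> < dmso_code e (Ex1 x \<phi>)" "dmso_code e \<phi> < dmso_code e (Ex2 X \<phi>)"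
  by (simp_all add: list_encode_greater del: list_encode.simps)

lemma recognizable_not:
  "recognizable \<Gamma> N D P \<Longrightarrow> recognizable \<Gamma> N D (\<lambda>u. \<not> P u)"
  unfolding recognizable_def recognizes_def by blast

lemma exists_marked_letter_iff:
  assumes "marked_once x v"
  shows "(\<exists>l \<in> set v. Inl x \<in> snd l \<and> p l) \<longleftrightarrow> p (v ! fo_val v x)"
proof
  assume "\<exists>l \<in> set v. Inl x \<in> snd l \<and> p l"
  then obtain i where "i < length v" "Inl x \<in> snd (v ! i)" "p (v ! i)" by (metis in_set_conv_nth)
  then show "p (v ! fo_val v x)" using fo_val_iff[OF assms] by simp
next
  assume "p (v ! fo_val v x)"
  then show "\<exists>l \<in> set v. Inl x \<in> snd l \<and> p l"
    using fo_val_less[OF assms] fo_val_iff[OF assms] by (metis nth_mem)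
qed

text \<open>A left-to-right reader notices only pairs whose first position does not come after the
  second, so both orders of \<open>x\<close> and \<open>y\<close> are combined, at
  \<open>2 * 2 ^ card R\<close> classes each.\<close>

lemma recognizable_Sim:
  fixes T :: "('s, 'r, 'a) transition set"
  assumes "finite R" "card R \<le> K" "\<And>t. t \<in> T \<Longrightarrow> treg t \<in> R"
  shows "recognizable (T \<times> UNIV) (4 ^ Suc K) (valid_words T {x, y}) (msat (Sim x y))"
proof -
  let ?D = "valid_words T {x, y}"
  let ?S = "\<lambda>x y (v :: ('s, 'r, 'a) mword). \<exists>j < length v. \<exists>i \<le> j. Inl x \<in> snd (v ! i) \<and> Inl y \<in> snd (v ! j) \<and>
    same_session (map fst v) i j"
  have pair: "recognizable (T \<times> UNIV) (2 * 2 ^ card R) ?D (?S x' y')" for x' y'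
    by (rule recognizable_session_pair[OF assms(1) _ valid_words_lists]) (use assms(3) in auto)
  have "recognizable (T \<times> UNIV) ((2 * 2 ^ card R) * (2 * 2 ^ card R)) ?D (\<lambda>v. ?S x y v \<or> ?S y x v)"
    by (rule recognizable_combine[OF pair[of x y] pair[of y x] valid_words_lists])
  then have "recognizable (T \<times> UNIV) ((2 * 2 ^ card R) * (2 * 2 ^ card R)) ?D (msat (Sim x y))"
  proof (rule recognizable_cong)
    fix v assume v: "v \<in> ?D"
    have S: "?S x y v \<longleftrightarrow> fo_val v x \<le> fo_val v y \<and> same_session (map fst v) (fo_val v x) (fo_val v y)"
      if m: "marked_once x v" "marked_once y v" for x y
    proof
      assume "?S x y v"
      then obtain i j where ij: "j < length v" "i \<le> j" "Inl x \<in> snd (v ! i)" "Inl y \<in> snd (v ! j)"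
        "same_session (map fst v) i j" by blast
      then have "i = fo_val v x" "j = fo_val v y"
        using fo_val_iff[OF m(1), of i] fo_val_iff[OF m(2), of j] by auto
      with ij show "fo_val v x \<le> fo_val v y \<and> same_session (map fst v) (fo_val v x) (fo_val v y)"
        by blast
    next
      assume "fo_val v x \<le> fo_val v y \<and> same_session (map fst v) (fo_val v x) (fo_val v y)"
      moreover have "Inl x \<in> snd (v ! fo_val v x)" "Inl y \<in> snd (v ! fo_val v y)"
        using fo_val_iff[OF m(1)] fo_val_iff[OF m(2)] fo_val_less[OF m(1)] fo_val_less[OF m(2)] by auto
      ultimately show "?S x y v" using fo_val_less[OF m(2)] by blast
    qed
    have m: "marked_once x v" "marked_once y v" using v by (auto simp: valid_words_def)
    have "?S x y v \<or> ?S y x v \<longleftrightarrow> msat (Sim x y) v"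
      unfolding S[OF m] S[OF m(2,1)] msat_def ssat.simps
      using same_session_sym[of "map fst v" "fo_val v x" "fo_val v y"] by linarith
    with v show "v \<in> ?D \<and> (?S x y v \<or> ?S y x v) = msat (Sim x y) v" by blast
  qed
  moreover have "(2 * 2 ^ card R) * (2 * 2 ^ card R) \<le> (4 :: nat) ^ Suc K"
  proof -
    have "(2 * 2 ^ card R) * (2 * 2 ^ card R) = (4 :: nat) ^ Suc (card R)"
      by (simp add: power_mult_distrib[symmetric])
    then show ?thesis using assms(2) by (simp add: power_increasing)
  qed
  ultimately show ?thesis by (rule recognizable_mono)
qed

lemma recognizable_msat:
  fixes T :: "('s, 'r, 'a) transition set" and e :: "'a \<Rightarrow> nat"
  assumes "finite R" "card R \<le> K" "\<And>t. t \<in> T \<Longrightarrow> treg t \<in> R"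
  shows "recognizable (T \<times> UNIV) (tower K (dmso_code e \<phi>)) (valid_words T (free1 \<phi>)) (msat \<phi>)"
proof -
  have "(4 :: nat) \<le> 4 ^ Suc K" by simp
  then have base: "N \<le> tower K k" if "N \<le> 4" for N k
    using that tower_ge[of K k] by linarith
  show ?thesis
  proof (induction \<phi>)
    case (Label x a)
    have iff: "(\<exists>l \<in> set v. Inl x \<in> snd l \<and> tlabel (fst l) = a) = msat (Label x a) v"
      if "v \<in> valid_words T {x}" for v
      using that exists_marked_letter_iff[of x v] fo_val_less[of x v]
      by (simp add: valid_words_def msat_def)
    have "recognizable (T \<times> UNIV) 2 (valid_words T {x}) (\<lambda>v. \<exists>l \<in> set v. Inl x \<in> snd l \<and> tlabel (fst l) = a)"
      by (rule recognizable_exists_letter[OF valid_words_lists])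
    then have "recognizable (T \<times> UNIV) 2 (valid_words T {x}) (msat (Label x a))"
      by (rule recognizable_cong) (use iff in simp)
    then show ?case unfolding free1.simps by (rule recognizable_mono) (rule base, simp)
  next
    case (Eq x y)
    have iff: "(\<exists>l \<in> set v. Inl x \<in> snd l \<and> Inl y \<in> snd l) = msat (Eq x y) v"
      if "v \<in> valid_words T {x, y}" for v
      using that exists_marked_letter_iff[of x v] fo_val_less[of x v] fo_val_iff[of y v]
      by (simp add: valid_words_def msat_def)
    have "recognizable (T \<times> UNIV) 2 (valid_words T {x, y}) (\<lambda>v. \<exists>l \<in> set v. Inl x \<in> snd l \<and> Inl y \<in> snd l)"
      by (rule recognizable_exists_letter[OF valid_words_lists])
    then have "recognizable (T \<times> UNIV) 2 (valid_words T {x, y}) (msat (Eq x y))"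
      by (rule recognizable_cong) (use iff in simp)
    then show ?case unfolding free1.simps by (rule recognizable_mono) (rule base, simp)
  next
    case (Mem x X)
    have iff: "(\<exists>l \<in> set v. Inl x \<in> snd l \<and> Inr X \<in> snd l) = msat (Mem x X) v"
      if "v \<in> valid_words T {x}" for v
      using that exists_marked_letter_iff[of x v] fo_val_less[of x v]
      by (simp add: valid_words_def msat_def so_val_def)
    have "recognizable (T \<times> UNIV) 2 (valid_words T {x}) (\<lambda>v. \<exists>l \<in> set v. Inl x \<in> snd l \<and> Inr X \<in> snd l)"
      by (rule recognizable_exists_letter[OF valid_words_lists])
    then have "recognizable (T \<times> UNIV) 2 (valid_words T {x}) (msat (Mem x X))"
      by (rule recognizable_cong) (use iff in simp)
    then show ?case unfolding free1.simps by (rule recognizable_mono) (rule base, simp)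
  next
    case (Succ x y)
    have iff: "(\<exists>i. Suc i < length v \<and> Inl x \<in> snd (v ! i) \<and> Inl y \<in> snd (v ! Suc i)) = msat (Succ x y) v"
      if "v \<in> valid_words T {x, y}" for v
    proof -
      have m: "marked_once x v" "marked_once y v" using that by (auto simp: valid_words_def)
      show ?thesis
        using fo_val_iff[OF m(1)] fo_val_iff[OF m(2)] fo_val_less[OF m(1)] fo_val_less[OF m(2)]
        by (auto simp: msat_def)
    qed
    have "recognizable (T \<times> UNIV) 4 (valid_words T {x, y}) (\<lambda>v. \<exists>i. Suc i < length v \<and> Inl x \<in> snd (v ! i) \<and> Inl y \<in> snd (v ! Suc i))"
      by (rule recognizable_exists_adjacent[OF valid_words_lists])
    then have "recognizable (T \<times> UNIV) 4 (valid_words T {x, y}) (msat (Succ x y))"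
      by (rule recognizable_cong) (use iff in simp)
    then show ?case unfolding free1.simps by (rule recognizable_mono) (rule base, simp)
  next
    case (Sim x y)
    then show ?case
      using recognizable_mono[OF recognizable_Sim[OF assms] tower_ge] by simp
  next
    case (Neg \<phi>)
    have "recognizable (T \<times> UNIV) (tower K (dmso_code e \<phi>)) (valid_words T (free1 (Neg \<phi>))) (msat (Neg \<phi>))"
      using recognizable_not[OF Neg.IH] by (simp add: msat_def[abs_def])
    then show ?case by (rule recognizable_mono) (intro tower_mono less_imp_le dmso_code_less)
  next
    case (Or \<phi> \<psi>)
    obtain k where k: "dmso_code e (Or \<phi> \<psi>) = Suc k"
      by (cases "dmso_code e (Or \<phi> \<psi>)") auto
    \<comment> \<open>Both parts fit on level \<open>k\<close>, which leaves one exponential for the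
      product.\<close>
    have le: "dmso_code e \<phi> \<le> k" "dmso_code e \<psi> \<le> k"
      using dmso_code_less(2,3)[where e = e and \<phi> = \<phi> and \<psi> = \<psi>]
      unfolding k less_Suc_eq_le .
    let ?D = "valid_words T (free1 (Or \<phi> \<psi>))"
    have "recognizable (T \<times> UNIV) (tower K k) ?D (msat \<phi>)"
      by (rule recognizable_cong[OF recognizable_mono[OF Or.IH(1) tower_mono[OF le(1)]]])
        (auto simp: valid_words_def)
    moreover have "recognizable (T \<times> UNIV) (tower K k) ?D (msat \<psi>)"
      by (rule recognizable_cong[OF recognizable_mono[OF Or.IH(2) tower_mono[OF le(2)]]])
        (auto simp: valid_words_def)
    ultimately have "recognizable (T \<times> UNIV) (tower K k * tower K k) ?D (\<lambda>v. msat \<phi> v \<or> msat \<psi> v)"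
      by (rule recognizable_combine[OF _ _ valid_words_lists])
    moreover have "tower K k * tower K k \<le> tower K (Suc k)"
    proof -
      have "t < 2 ^ t" for t :: nat by (rule less_exp)
      then have "t * t \<le> 2 ^ t * 2 ^ t" for t :: nat by (intro mult_mono) (auto intro: less_imp_le)
      moreover have "(2 :: nat) ^ t * 2 ^ t \<le> 8 ^ t" for t
        unfolding power_mult_distrib[symmetric] by (rule power_mono) auto
      ultimately show ?thesis unfolding tower_Suc using order.trans by blast
    qed
    ultimately show ?case
      unfolding k by (auto simp: msat_def[abs_def] intro: recognizable_mono)
  next
    case (Ex1 x \<phi>)
    obtain k where k: "dmso_code e (Ex1 x \<phi>) = Suc k"
      by (cases "dmso_code e (Ex1 x \<phi>)") auto
    have le: "dmso_code e \<phi> \<le> k"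
      using dmso_code_less(4)[of e \<phi> x] unfolding k less_Suc_eq_le .
    let ?D = "valid_words T (free1 \<phi> - {x})"
    \<comment> \<open>If \<open>x\<close> is free in \<open>\<phi>\<close>, the induction hypothesis
      speaks only of words that mark \<open>x\<close> once, hence the guard before the
      projection.\<close>
    have "recognizable (T \<times> UNIV) (3 * tower K k) ?D (\<lambda>v. marked_once x v \<and> msat \<phi> v)"
    proof (rule recognizable_guard)
      show "recognizable (T \<times> UNIV) (tower K k) {v \<in> ?D. marked_once x v} (msat \<phi>)"
        by (rule recognizable_cong[OF recognizable_mono[OF Ex1.IH tower_mono[OF le]]])
          (auto simp: valid_words_def)
    qed (use recognizable_marked_once valid_words_lists in blast)+
    then have "recognizable (T \<times> UNIV) (2 ^ (3 * tower K k)) ?D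
        (\<lambda>u. \<exists>v \<in> ?D. agree_off (Inl x) u v \<and> marked_once x v \<and> msat \<phi> v)"
      unfolding agree_off_def
      by (rule recognizable_project[OF _ valid_words_lists])
        (rule agree_off_valid_words[unfolded agree_off_def], auto)
    then have "recognizable (T \<times> UNIV) (2 ^ (3 * tower K k)) ?D (msat (Ex1 x \<phi>))"
      by (rule recognizable_cong) (simp add: msat_Ex1_iff)
    then show ?case unfolding k by (simp add: tower_Suc power_mult)
  next
    case (Ex2 X \<phi>)
    obtain k where k: "dmso_code e (Ex2 X \<phi>) = Suc k"
      by (cases "dmso_code e (Ex2 X \<phi>)") auto
    have le: "dmso_code e \<phi> \<le> k"
      using dmso_code_less(5)[of e \<phi> X] unfolding k less_Suc_eq_le .
    let ?D = "valid_words T (free1 \<phi>)"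
    have "recognizable (T \<times> UNIV) (2 ^ tower K k) ?D
        (\<lambda>u. \<exists>v \<in> ?D. agree_off (Inr X) u v \<and> msat \<phi> v)"
      unfolding agree_off_def
      by (rule recognizable_project[OF recognizable_mono[OF Ex2.IH tower_mono[OF le]] valid_words_lists])
        (rule agree_off_valid_words[unfolded agree_off_def], auto)
    then have "recognizable (T \<times> UNIV) (2 ^ tower K k) ?D (msat (Ex2 X \<phi>))"
      by (rule recognizable_cong) (simp add: msat_Ex2_iff)
    moreover have "2 ^ tower K k \<le> tower K (Suc k)"
      unfolding tower_Suc by (rule power_mono) auto
    ultimately show ?case unfolding k by (auto intro: recognizable_mono)
  qed
qed

lemma recognizable_ssat:
  fixes T :: "('s, 'r, 'a) transition set" and e :: "'a \<Rightarrow> nat"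
  assumes "finite R" "card R \<le> K" "\<And>t. t \<in> T \<Longrightarrow> treg t \<in> R" "is_sentence \<phi>"
  shows "recognizable T (tower K (dmso_code e \<phi>)) (lists T) (\<lambda>u. ssat u \<sigma> \<rho> \<phi>)"
proof -
  have "recognizable (T \<times> UNIV) (tower K (dmso_code e \<phi>)) (valid_words T {}) (msat \<phi>)"
    using recognizable_msat[OF assms(1-3), where \<phi> = \<phi> and e = e] assms(4) by (simp add: is_sentence_def)
  then have "recognizable T (tower K (dmso_code e \<phi>)) (lists T) (\<lambda>u. msat \<phi> (map (\<lambda>t. (t, {})) u))"
    by (rule recognizable_map) (auto simp: valid_words_def)
  moreover have "msat \<phi> (map (\<lambda>t. (t, {})) u) = ssat u \<sigma> \<rho> \<phi>"
    for u :: "('s, 'r, 'a) transition list"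
    unfolding msat_def map_map comp_def fst_conv map_ident
    by (rule ssat_cong) (use assms(4) in \<open>auto simp: is_sentence_def\<close>)
  ultimately show ?thesis by simp
qed

section \<open>Symbolic runs\<close>

abbreviation source :: "('s, 'r, 'a) transition \<Rightarrow> 's" where "source \<equiv> fst"

abbreviation target :: "('s, 'r, 'a) transition \<Rightarrow> 's" where "target t \<equiv> snd (snd t)"

definition state_after :: "'s \<Rightarrow> ('s, 'r, 'a) transition list \<Rightarrow> nat \<Rightarrow> 's" where
  "state_after q u i = (if i = 0 then q else target (u ! (i - 1)))"

definition connected :: "'s \<Rightarrow> ('s, 'r, 'a) transition list \<Rightarrow> bool" where
  "connected q u \<longleftrightarrow> (\<forall>i < length u. source (u ! i) = state_after q u i)"

definition initialized :: "('s, 'r, 'a) transition list \<Rightarrow> bool" where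
  "initialized u \<longleftrightarrow> (\<forall>i < length u. taction (u ! i) = Fresh (treg (u ! i)) \<or>
    (\<exists>j < i. taction (u ! j) = Fresh (treg (u ! i))))"

definition symbolic_path ::
    "('s, 'r, 'a) session_automaton \<Rightarrow> ('s, 'r, 'a) transition list \<Rightarrow> bool" where
  "symbolic_path A u \<longleftrightarrow> u \<in> lists (transitions A) \<and> connected (initial A) u \<and> initialized u"

definition symbolic_run ::
    "('s, 'r, 'a) session_automaton \<Rightarrow> ('s, 'r, 'a) transition list \<Rightarrow> bool" where
  "symbolic_run A u \<longleftrightarrow> symbolic_path A u \<and> state_after (initial A) u (length u) \<in> final A"

lemma state_after_snoc: "i \<le> length u \<Longrightarrow> state_after q (u @ [t]) i = state_after q u i"
  by (auto simp: state_after_def nth_append)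

lemma state_after_Nil: "state_after q [] 0 = q"
  by (simp add: state_after_def)

lemma state_after_last: "state_after q (u @ [t]) (Suc (length u)) = target t"
  by (simp add: state_after_def)

lemma connected_snoc:
  "connected q (u @ [t]) \<longleftrightarrow> connected q u \<and> source t = state_after q u (length u)"
  by (auto simp: connected_def All_less_Suc nth_append state_after_snoc)

lemma initialized_snoc:
  "initialized (u @ [t]) \<longleftrightarrow> initialized u \<and>
    (taction t = Fresh (treg t) \<or> (\<exists>t' \<in> set u. taction t' = Fresh (treg t)))"
proof -
  have "(\<exists>t' \<in> set u. p t') \<longleftrightarrow> (\<exists>j < length u. p (u ! j))" for p
    by (metis in_set_conv_nth)
  then show ?thesis
    by (simp add: initialized_def All_less_Suc nth_append conj_commute cong: conj_cong)
qed

lemma symbolic_path_snoc: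
  "symbolic_path A (u @ [t]) \<longleftrightarrow> symbolic_path A u \<and> t \<in> transitions A \<and>
    source t = state_after (initial A) u (length u) \<and>
    (taction t = Fresh (treg t) \<or> (\<exists>t' \<in> set u. taction t' = Fresh (treg t)))"
  by (auto simp: symbolic_path_def connected_snoc initialized_snoc)

lemma symbolic_path_Nil: "symbolic_path A []"
  by (simp add: symbolic_path_def connected_def initialized_def)

text \<open>Records the transitions and grows at the end, the direction in which the congruences and
  the invariants below are extended. The side condition merges both kinds of register access into
  one rule.\<close>

inductive labelled_run :: "('s, 'r, 'a) session_automaton \<Rightarrow> ('s, 'r, 'a) transition list \<Rightarrow>
    ('a \<times> 'd) list \<Rightarrow> ('s, 'r, 'd) config \<Rightarrow> bool" for A where
  Nil: "labelled_run A [] [] (initial A, Map.empty, {})"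
| snoc: "labelled_run A u w (s, \<tau>, U) \<Longrightarrow> (s, (a, p), s') \<in> transitions A \<Longrightarrow>
    (p = Fresh r \<and> d \<notin> U \<or> p = Reuse r \<and> \<tau> r = Some d) \<Longrightarrow>
    labelled_run A (u @ [(s, (a, p), s')]) (w @ [(a, d)]) (s', \<tau>(r \<mapsto> d), U \<union> {d})"

lemma run_snoc: "run A c w c' \<Longrightarrow> step A c' x c'' \<Longrightarrow> run A c (w @ [x]) c''"
  by (induction rule: run.induct) (auto intro: run.intros)

inductive_cases run_NilE: "run A c [] c'"
inductive_cases run_ConsE: "run A c (x # w) c'"

lemma run_snocD: "run A c (w @ [x]) c'' \<Longrightarrow> \<exists>c'. run A c w c' \<and> step A c' x c''"
proof (induction w arbitrary: c)
  case Nil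
  then have "step A c x c''" by (auto elim!: run_ConsE run_NilE)
  then show ?case using run.Nil by blast
next
  case (Cons y w)
  from Cons.prems obtain c1 where "step A c y c1" "run A c1 (w @ [x]) c''"
    by (auto elim: run_ConsE)
  with Cons.IH show ?case using run.Cons by blast
qed

lemma labelled_run_imp_run:
  "labelled_run A u w c \<Longrightarrow> run A (initial A, Map.empty, {}) w c"
proof (induction rule: labelled_run.induct)
  case (snoc u w s \<tau> U a p s' r d)
  then have "step A (s, \<tau>, U) (a, d) (s', \<tau>(r \<mapsto> d), U \<union> {d})" by (blast intro: step.intros)
  with snoc.IH show ?case by (rule run_snoc)
qed (rule run.Nil)

lemma run_imp_labelled_run:
  "run A (initial A, Map.empty, {}) w c \<Longrightarrow> \<exists>u. labelled_run A u w c"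
proof (induction w arbitrary: c rule: rev_induct)
  case Nil
  then show ?case using labelled_run.Nil by (auto elim!: run_NilE)
next
  case (snoc x w)
  then obtain c' where c': "run A (initial A, Map.empty, {}) w c'" "step A c' x c"
    by (blast dest: run_snocD)
  then obtain u where "labelled_run A u w c'" using snoc.IH by blast
  with c'(2) show ?case by (cases rule: step.cases) (blast intro: labelled_run.snoc)+
qed

lemma same_session_snoc:
  "i < length u \<Longrightarrow> j < length u \<Longrightarrow> same_session (u @ [t]) i j = same_session u i j"
  by (auto simp: same_session_def nth_append)

lemma same_session_refl: "same_session u i i"
  by (auto simp: same_session_def)

text \<open>The parts need each other: comparing a new position with older ones uses that
  \<open>U\<close> holds all values read so far (a fresh value equals none) and that each register
  stores the value of its still open session.\<close>

lemma labelled_run_invariant: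
  assumes "labelled_run A u w c"
  shows "length w = length u"
    and "\<And>i. i < length u \<Longrightarrow> fst (w ! i) = tlabel (u ! i)"
    and "snd (snd c) = snd ` set w"
    and "dom (fst (snd c)) = treg ` set u"
    and "\<And>r d. fst (snd c) r = Some d \<Longrightarrow> \<exists>i < length u. treg (u ! i) = r \<and> snd (w ! i) = d \<and>
      (\<forall>k < length u. i < k \<longrightarrow> taction (u ! k) \<noteq> Fresh r)"
    and "\<And>i j. i < length u \<Longrightarrow> j < length u \<Longrightarrow> snd (w ! i) = snd (w ! j) \<longleftrightarrow> same_session u i j"
  using assms
proof (induction rule: labelled_run.induct)
  case Nil
  { case 1 show ?case by simp next
    case 2 then show ?case by simp next
    case 3 show ?case by simp next
    case 4 show ?case by simp next
    case 5 then show ?case by simp next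
    case 6 then show ?case by simp }
next
  case (snoc u w s \<tau> U a p s' r d)
  let ?t = "(s, (a, p), s')"
  have t: "treg ?t = r" "tlabel ?t = a" "taction ?t = p"
    using snoc.hyps(3) by (auto simp: treg_def taction_def tlabel_def)
  note IH = snoc.IH[unfolded fst_conv snd_conv]
  have new: "snd (w ! i) = d \<longleftrightarrow> same_session (u @ [?t]) i (length u)" if i: "i < length u" for i
    using snoc.hyps(3)
  proof
    assume p: "p = Fresh r \<and> d \<notin> U"
    then have "snd (w ! i) \<noteq> d" using i IH(1,3) by (metis image_eqI nth_mem)
    moreover have "\<not> same_session (u @ [?t]) i (length u)"
      using i p t by (auto simp: same_session_def)
    ultimately show ?thesis by simp
  next
    assume p: "p = Reuse r \<and> \<tau> r = Some d"
    \<comment> \<open>\<open>i0\<close> belongs to the session open in \<open>r\<close>. Carrying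
      the value \<open>d\<close> thus means sharing a session with \<open>i0\<close>, and since no
      refresh follows \<open>i0\<close>, that session reaches the new position.\<close>
    then obtain i0 where i0: "i0 < length u" "treg (u ! i0) = r" "snd (w ! i0) = d"
      "\<And>k. k < length u \<Longrightarrow> i0 < k \<Longrightarrow> taction (u ! k) \<noteq> Fresh r"
      using IH(5)[of r d] by blast
    have "snd (w ! i) = d \<longleftrightarrow> same_session u i i0" using IH(6)[OF i i0(1)] i0(3) by simp
    also have "\<dots> \<longleftrightarrow> treg (u ! i) = r \<and> (\<forall>k < length u. i < k \<longrightarrow> taction (u ! k) \<noteq> Fresh r)"
    proof (cases "i \<le> i0")
      case True
      have "(\<forall>k. i < k \<and> k \<le> i0 \<longrightarrow> taction (u ! k) \<noteq> Fresh r) \<longleftrightarrow>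
        (\<forall>k < length u. i < k \<longrightarrow> taction (u ! k) \<noteq> Fresh r)"
        using i0 by (metis le_less_trans not_le)
      with True i0(2) show ?thesis by (auto simp: same_session_def)
    next
      case False
      then have "same_session u i i0 \<longleftrightarrow> treg (u ! i) = r"
        using i i0 by (auto simp: same_session_def)
      with False i0(4) show ?thesis by auto
    qed
    also have "\<dots> \<longleftrightarrow> same_session (u @ [?t]) i (length u)"
      using i t p by (auto simp: same_session_def nth_append le_less)
    finally show ?thesis .
  qed
  { case 1 show ?case using IH(1) by simp next
    case 2 then show ?case using IH(1,2) t by (auto simp: nth_append less_Suc_eq) next
    case 3 show ?case using IH(3) by simp next
    case 4 show ?case using IH(4) t by (simp only: fst_conv snd_conv dom_fun_upd) simp next
    case (5 r' d')
    show ?case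
    proof (cases "r' = r")
      case True
      with 5 t IH(1) show ?thesis by (intro exI[of _ "length u"]) (auto simp: nth_append)
    next
      case False
      with 5 obtain i where "i < length u" "treg (u ! i) = r'" "snd (w ! i) = d'"
        "\<forall>k < length u. i < k \<longrightarrow> taction (u ! k) \<noteq> Fresh r'"
        using IH(5)[of r' d'] by auto
      moreover have "p \<noteq> Fresh r'" using False snoc.hyps(3) by auto
      ultimately show ?thesis using t IH(1)
        by (intro exI[of _ i]) (auto simp: nth_append less_Suc_eq)
    qed next
    case (6 i j)
    then consider "i < length u" "j < length u" | "i < length u" "j = length u"
      | "i = length u" "j < length u" | "i = length u" "j = length u"
      by fastforce
    then show ?case
    proof cases
      case 1
      then show ?thesis using IH(1) IH(6)[of i j] by (simp add: nth_append same_session_snoc)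
    next
      case 2
      then show ?thesis using IH(1) new[of i] by (simp add: nth_append)
    next
      case 3
      then show ?thesis
        using IH(1) new[of j] same_session_sym[of "u @ [?t]" i j] by (auto simp: nth_append)
    next
      case 4
      then show ?thesis by (simp add: same_session_refl)
    qed }
qed

lemma labelled_run_symbolic_path:
  "labelled_run A u w c \<Longrightarrow> symbolic_path A u \<and> fst c = state_after (initial A) u (length u)"
proof (induction rule: labelled_run.induct)
  case Nil
  show ?case by (simp add: symbolic_path_Nil state_after_Nil)
next
  case (snoc u w s \<tau> U a p s' r d)
  let ?t = "(s, (a, p), s')"
  have t: "treg ?t = r" "taction ?t = p"
    using snoc.hyps(3) by (auto simp: treg_def taction_def)
  \<comment> \<open>A reusable register holds a value, so some earlier position accessed it;
    initialization of the prefix then yields a refresh at or before that position.\<close>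
  have "\<exists>t' \<in> set u. taction t' = Fresh r" if "p = Reuse r"
  proof -
    have "\<tau> r = Some d" using that snoc.hyps(3) by simp
    then obtain i where i: "i < length u" "treg (u ! i) = r"
      using labelled_run_invariant(5)[OF snoc.hyps(1), of r d] by auto
    moreover have "initialized u" using snoc.IH by (simp add: symbolic_path_def)
    ultimately show ?thesis unfolding initialized_def by (metis nth_mem order.strict_trans)
  qed
  then show ?case
    using snoc.IH snoc.hyps(2,3) t by (auto simp: symbolic_path_snoc state_after_last)
qed

text \<open>Values are chosen along the path: \<open>U\<close> is finite and the data domain
  infinite, so a \<open>Fresh\<close> finds a new value; initialization guarantees that a
  \<open>Reuse\<close> finds its register filled.\<close>

lemma symbolic_path_labelled_run:
  assumes "infinite (UNIV :: 'd set)" "symbolic_path A u"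
  shows "\<exists>(w :: ('a \<times> 'd) list) \<tau> U. labelled_run A u w (state_after (initial A) u (length u), \<tau>, U)"
  using assms(2)
proof (induction u rule: rev_induct)
  case Nil
  show ?case using labelled_run.Nil by (auto simp: state_after_Nil)
next
  case (snoc t u)
  obtain s a p s' where t: "t = (s, (a, p), s')" by (cases t) auto
  from snoc obtain w :: "('a \<times> 'd) list" and \<tau> U where w: "labelled_run A u w (s, \<tau>, U)"
    by (auto simp: symbolic_path_snoc t)
  have tA: "(s, (a, p), s') \<in> transitions A" using snoc.prems unfolding symbolic_path_snoc t by blast
  have "\<exists>d r. p = Fresh r \<and> d \<notin> U \<or> p = Reuse r \<and> \<tau> r = Some d"
  proof (cases p)
    case (Fresh r)
    have "finite U" using labelled_run_invariant(3)[OF w] by simp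
    then obtain d where "d \<notin> U" using assms(1) ex_new_if_finite by blast
    with Fresh show ?thesis by blast
  next
    case (Reuse r)
    then have "\<exists>t' \<in> set u. taction t' = Fresh r"
      using snoc.prems by (auto simp: symbolic_path_snoc t treg_def taction_def)
    then have "r \<in> treg ` set u" by (force simp: treg_def)
    then have "r \<in> dom \<tau>" using labelled_run_invariant(4)[OF w] by simp
    with Reuse show ?thesis by blast
  qed
  then obtain d r where "p = Fresh r \<and> d \<notin> U \<or> p = Reuse r \<and> \<tau> r = Some d" by blast
  from labelled_run.snoc[OF w tA this] show ?case
    unfolding t by (auto simp: state_after_last)
qed

text \<open>Word and transition sequence are related only at positions inside the word, so free
  positions must lie there; quantification over positions preserves this.\<close>

lemma sat_iff_ssat:
  assumes "length w = length u" "\<And>i. i < length u \<Longrightarrow> fst (w ! i) = tlabel (u ! i)"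
    "\<And>i j. i < length u \<Longrightarrow> j < length u \<Longrightarrow> snd (w ! i) = snd (w ! j) \<longleftrightarrow> same_session u i j"
    "\<And>x. x \<in> free1 \<phi> \<Longrightarrow> \<sigma> x < length u"
  shows "sat w \<sigma> \<rho> \<phi> \<longleftrightarrow> ssat u \<sigma> \<rho> \<phi>"
  using assms(4)
proof (induction \<phi> arbitrary: \<sigma> \<rho>)
  case (Ex1 x \<phi>)
  have "sat w (\<sigma>(x := i)) \<rho> \<phi> \<longleftrightarrow> ssat u (\<sigma>(x := i)) \<rho> \<phi>" if "i < length u" for i
    by (rule Ex1.IH) (use Ex1.prems that in auto)
  then show ?case using assms(1) by auto
qed (use assms(1-3) in auto)

lemma inclusion_iff_symbolic:
  fixes A :: "('s, 'r, 'a) session_automaton"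
  assumes "infinite (UNIV :: 'd set)" "is_sentence \<phi>"
  shows "(automaton_lang A :: ('a \<times> 'd) list set) \<subseteq> dmso_lang \<phi> \<longleftrightarrow>
    (\<forall>u. symbolic_run A u \<longrightarrow> ssat u (\<lambda>_. 0) (\<lambda>_. {}) \<phi>)"
proof -
  have sat: "w \<in> dmso_lang \<phi> \<longleftrightarrow> ssat u (\<lambda>_. 0) (\<lambda>_. {}) \<phi>"
    if "labelled_run A u w c" for u c and w :: "('a \<times> 'd) list"
    unfolding dmso_lang_def mem_Collect_eq
    by (rule sat_iff_ssat)
      (use labelled_run_invariant[OF that] assms(2) in \<open>auto simp: is_sentence_def\<close>)
  have "w \<in> automaton_lang A \<longleftrightarrow> (\<exists>u c. labelled_run A u w c \<and> symbolic_run A u)"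
    for w :: "('a \<times> 'd) list"
  proof
    assume "w \<in> automaton_lang A"
    then obtain s \<tau> U where "run A (initial A, Map.empty, {}) w (s, \<tau>, U)" "s \<in> final A"
      by (auto simp: automaton_lang_def)
    then show "\<exists>u c. labelled_run A u w c \<and> symbolic_run A u"
      using run_imp_labelled_run labelled_run_symbolic_path unfolding symbolic_run_def
      by (metis fst_conv)
  next
    assume "\<exists>u c. labelled_run A u w c \<and> symbolic_run A u"
    then show "w \<in> automaton_lang A"
      using labelled_run_imp_run labelled_run_symbolic_path
      unfolding symbolic_run_def automaton_lang_def by (metis (mono_tags, lifting) mem_Collect_eq prod.collapse)
  qed
  moreover have "\<exists>(w :: ('a \<times> 'd) list) c. labelled_run A u w c" if "symbolic_run A u" for u
    using symbolic_path_labelled_run[OF assms(1)] that unfolding symbolic_run_def by blast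
  ultimately show ?thesis using sat by blast
qed

text \<open>The factors count the classes for connection and acceptance (current state, or a sink
  \<open>None\<close>), for initialization (a flag and the registers refreshed so far) and for the
  sentence.\<close>

lemma short_symbolic_counterexample:
  fixes A :: "('s, 'r, 'a) session_automaton" and e :: "'a \<Rightarrow> nat"
  assumes A: "is_session_automaton A" and K: "card (states A) \<le> K" "card (registers A) \<le> K"
    and "is_sentence \<phi>" and u: "symbolic_run A u" "\<not> ssat u \<sigma> \<rho> \<phi>"
  obtains v where "symbolic_run A v" "\<not> ssat v \<sigma> \<rho> \<phi>"
    "length v < Suc K * (2 * 2 ^ K) * tower K (dmso_code e \<phi>)"
proof -
  let ?T = "transitions A" and ?S = "states A" and ?R = "registers A" and ?q = "initial A"
  have fin: "finite ?S" "finite ?R" "?q \<in> ?S" using A by (auto simp: is_session_automaton_def)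
  have T: "target t \<in> ?S" "treg t \<in> ?R" if "t \<in> ?T" for t
    using A that by (force simp: is_session_automaton_def treg_def taction_def)+
  have state: "state_after ?q u (length u) \<in> ?S" if "u \<in> lists ?T" for u
    using that fin(3) T(1) by (cases u rule: rev_cases) (auto simp: state_after_Nil state_after_last)
  define g where "g u = (if connected ?q u then Some (state_after ?q u (length u)) else None)" for u :: "('s, 'r, 'a) transition list"
  have g_snoc: "g (u @ [t]) = (if g u = Some (source t) then Some (target t) else None)" for u t
    by (auto simp: g_def connected_snoc state_after_last)
  have "recognizable ?T (Suc (card ?S)) (lists ?T)
    (\<lambda>u. connected ?q u \<and> state_after ?q u (length u) \<in> final A)"
  proof (rule recognizableI[where g = g and Q = "insert None (Some ` ?S)"])
    show "card (insert None (Some ` ?S)) \<le> Suc (card ?S)"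
      using fin(1) by (simp add: card_insert_if card_image)
  next
    fix u v assume "g u = g v"
    then show "(connected ?q u \<and> state_after ?q u (length u) \<in> final A) =
      (connected ?q v \<and> state_after ?q v (length v) \<in> final A)"
      by (auto simp: g_def split: if_splits)
  qed (use fin state g_snoc in \<open>auto simp: g_def\<close>)
  then have conn: "recognizable ?T (Suc K) (lists ?T)
    (\<lambda>u. connected ?q u \<and> state_after ?q u (length u) \<in> final A)"
    by (rule recognizable_mono) (use K in simp)
  define h where "h u = {r. \<exists>t \<in> set u. taction t = Fresh r}" for u :: "('s, 'r, 'a) transition list"
  have h_snoc: "h (u @ [t]) = h u \<union> {r. taction t = Fresh r}" for u t
    by (auto simp: h_def)
  have init_snoc: "initialized (u @ [t]) \<longleftrightarrow> initialized u \<and> (taction t = Fresh (treg t) \<or> treg t \<in> h u)"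
    for u :: "('s, 'r, 'a) transition list" and t
    by (simp add: initialized_snoc h_def)
  have "recognizable ?T (2 * 2 ^ card ?R) (lists ?T) initialized"
  proof (rule recognizableI[where g = "\<lambda>u. (initialized u, h u)" and Q = "UNIV \<times> Pow ?R"])
    show "card ((UNIV :: bool set) \<times> Pow ?R) \<le> 2 * 2 ^ card ?R"
      using fin(2) by (simp add: card_cartesian_product card_Pow)
  next
    fix u assume "u \<in> lists ?T"
    then have "h u \<subseteq> ?R" using T(2) by (force simp: h_def treg_def)
    then show "(initialized u, h u) \<in> UNIV \<times> Pow ?R" by simp
  qed (use fin in \<open>auto simp: init_snoc h_snoc\<close>)
  then have "recognizable ?T (2 * 2 ^ K) (lists ?T) initialized"
    by (rule recognizable_mono) (use K in simp)
  then have "recognizable ?T (Suc K * (2 * 2 ^ K)) (lists ?T)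
    (\<lambda>u. (connected ?q u \<and> state_after ?q u (length u) \<in> final A) \<and> initialized u)"
    by (rule recognizable_combine[OF conn _ order_refl])
  moreover have "recognizable ?T (tower K (dmso_code e \<phi>)) (lists ?T) (\<lambda>u. ssat u \<sigma> \<rho> \<phi>)"
    by (rule recognizable_ssat[OF fin(2) K(2) T(2) assms(4)])
  ultimately have rec: "recognizable ?T (Suc K * (2 * 2 ^ K) * tower K (dmso_code e \<phi>)) (lists ?T)
    (\<lambda>u. ((connected ?q u \<and> state_after ?q u (length u) \<in> final A) \<and> initialized u) \<and>
      \<not> ssat u \<sigma> \<rho> \<phi>)"
    by (rule recognizable_combine[OF _ _ order_refl, where F = "\<lambda>a b. a \<and> \<not> b"])
  obtain v where "v \<in> lists ?T" "((connected ?q v \<and> state_after ?q v (length v) \<in> final A) \<and> initialized v) \<and>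
      \<not> ssat v \<sigma> \<rho> \<phi>" "length v < Suc K * (2 * 2 ^ K) * tower K (dmso_code e \<phi>)"
    by (rule recognizable_short_witness[OF rec, of u])
      (use u in \<open>simp_all add: symbolic_run_def symbolic_path_def\<close>)
  then show ?thesis using that unfolding symbolic_run_def symbolic_path_def by blast
qed

section \<open>The decision procedure\<close>

definition code_reg :: "nat \<Rightarrow> nat" where
  "code_reg m = snd (prod_decode (code_nth m 2))"

definition code_fresh :: "nat \<Rightarrow> bool" where
  "code_fresh m \<longleftrightarrow> fst (prod_decode (code_nth m 2)) = 0"

text \<open>Bounded form of \<open>same_session\<close>: the disjunctions say
  \<open>min i j < k\<close> and \<open>k \<le> max i j\<close>, and \<open>Suc (i + j)\<close>
  exceeds every such \<open>k\<close>.\<close>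

definition code_session :: "nat \<Rightarrow> nat \<Rightarrow> nat \<Rightarrow> bool" where
  "code_session u i j \<longleftrightarrow> code_reg (code_nth u i) = code_reg (code_nth u j) \<and>
    (\<forall>k < Suc (i + j). (i < k \<or> j < k) \<and> (k \<le> i \<or> k \<le> j) \<longrightarrow>
      \<not> (code_fresh (code_nth u k) \<and> code_reg (code_nth u k) = code_reg (code_nth u i)))"

text \<open>Entries 2, 3 and 4 of an automaton code are its initial state, final states and
  transitions; entries 0 and 3 of a transition code are its source and target.\<close>

definition code_state :: "nat \<Rightarrow> nat \<Rightarrow> nat \<Rightarrow> nat" where
  "code_state a u i = (if i = 0 then code_nth a 2 else code_nth (code_nth u (i - 1)) 3)"

definition code_run :: "nat \<Rightarrow> nat \<Rightarrow> nat \<Rightarrow> bool" where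
  "code_run a n u \<longleftrightarrow>
    (\<forall>i < n. code_nth u i \<in> set_decode (code_nth a 4) \<and>
      code_nth (code_nth u i) 0 = code_state a u i \<and>
      (code_fresh (code_nth u i) \<or>
        (\<exists>j < i. code_fresh (code_nth u j) \<and> code_reg (code_nth u j) = code_reg (code_nth u i)))) \<and>
    code_state a u n \<in> set_decode (code_nth a 3)"

text \<open>
  An environment is the code of a list of length \<open>V\<close>: its entry \<open>2 * x\<close> is the value of the
  first-order variable \<open>x\<close> and its entry \<open>2 * X + 1\<close> encodes the value of the second-order variable \<open>X\<close>.
\<close>

definition code_update :: "nat \<Rightarrow> nat \<Rightarrow> nat \<Rightarrow> nat \<Rightarrow> nat" where
  "code_update V v z i = code_tabulate V (\<lambda>y. if y = z then i else code_nth v y)"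

text \<open>The tags 0 to 8 are those of \<open>dmso_code\<close>. Recursive calls are look-ups in
  \<open>t\<close>, the previous table, where nonzero means true; set values run through the numbers
  below \<open>2 ^ n\<close>, the codes of sets of positions.\<close>

definition eval_clause :: "nat \<Rightarrow> nat \<Rightarrow> nat \<Rightarrow> nat \<Rightarrow> nat \<Rightarrow> nat \<Rightarrow> bool" where
  "eval_clause V n u t p v \<longleftrightarrow>
    code_nth p 0 = 0 \<and> code_nth (code_nth u (code_nth v (2 * code_nth p 1))) 1 = code_nth p 2 \<or>
    code_nth p 0 = 1 \<and> code_nth v (2 * code_nth p 1) = code_nth v (2 * code_nth p 2) \<or>
    code_nth p 0 = 2 \<and> code_nth v (2 * code_nth p 2) = Suc (code_nth v (2 * code_nth p 1)) \<or>
    code_nth p 0 = 3 \<and> code_session u (code_nth v (2 * code_nth p 1)) (code_nth v (2 * code_nth p 2)) \<or>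
    code_nth p 0 = 4 \<and>
      code_nth v (2 * code_nth p 1) \<in> set_decode (code_nth v (Suc (2 * code_nth p 2))) \<or>
    code_nth p 0 = 5 \<and> code_nth t (prod_encode (code_nth p 1, v)) = 0 \<or>
    code_nth p 0 = 6 \<and> (\<not> code_nth t (prod_encode (code_nth p 1, v)) = 0 \<or>
      \<not> code_nth t (prod_encode (code_nth p 2, v)) = 0) \<or>
    code_nth p 0 = 7 \<and> (\<exists>i < n. \<not> code_nth t
      (prod_encode (code_nth p 2, code_update V v (2 * code_nth p 1) i)) = 0) \<or>
    code_nth p 0 = 8 \<and> (\<exists>i < 2 ^ n. \<not> code_nth t
      (prod_encode (code_nth p 2, code_update V v (Suc (2 * code_nth p 1)) i)) = 0)"

text \<open>
  The \<open>k\<close>-th table holds the truth values at all pairs of a formula and an environment; its entries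
  are correct for formulas with code less than \<open>k\<close>, because subformulas have smaller codes.
\<close>

definition eval_table :: "nat \<Rightarrow> nat \<Rightarrow> nat \<Rightarrow> nat \<Rightarrow> nat \<Rightarrow> nat" where
  "eval_table V n u M k = rec_nat 0 (\<lambda>_ t. code_tabulate M
    (\<lambda>x. of_bool (eval_clause V n u t (fst (prod_decode x)) (snd (prod_decode x))))) k"

text \<open>An instance code is at least the number of states, the number of registers and the code
  of the sentence, so \<open>c\<close> replaces all three in the length bound.\<close>

definition decide_bound :: "nat \<Rightarrow> nat" where
  "decide_bound c = Suc c * (2 * 2 ^ c) * tower c c"

text \<open>One more than a bound on the relevant indices: formula codes are at most
  \<open>c\<close>, environments have \<open>2 * c\<close> entries, and positions as well as set
  codes are below \<open>2 ^ n\<close>.\<close>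

definition table_size :: "nat \<Rightarrow> nat \<Rightarrow> nat" where
  "table_size c n = Suc (prod_encode (c, code_tabulate (2 * c) (\<lambda>_. 2 ^ n)))"

text \<open>\<open>n\<close> is the length and \<open>u\<close> the code of a transition sequence;
  transition codes are at most \<open>c\<close>, and list codes are monotone in their entries.
  Numbers \<open>u\<close> that describe no accepting run are discarded by \<open>code_run\<close>.
  Free variables of subformulas are below \<open>c\<close>, hence \<open>2 * c\<close> slots;
  \<open>Suc c\<close> rounds reach every formula with code at most \<open>c\<close>.\<close>

definition decide :: "nat \<Rightarrow> bool" where
  "decide c \<longleftrightarrow> (\<forall>n < decide_bound c. \<forall>u < Suc (code_tabulate n (\<lambda>_. c)).
    code_run (fst (prod_decode c)) n u \<longrightarrow>
    \<not> code_nth (eval_table (2 * c) n u (table_size c n) (Suc c))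
      (prod_encode (snd (prod_decode c), code_tabulate (2 * c) (\<lambda>_. 0))) = 0)"

section \<open>Computability of the decision procedure\<close>

lemma computable_code_reg: "computable n f \<Longrightarrow> computable n (\<lambda>xs. code_reg (f xs))"
  unfolding code_reg_def by (rule computable_intros | assumption)+

lemma computable_code_fresh: "computable n f \<Longrightarrow> computable_rel n (\<lambda>xs. code_fresh (f xs))"
  unfolding code_fresh_def by (rule computable_intros | assumption)+

lemma computable_code_session:
  "computable n f \<Longrightarrow> computable n g \<Longrightarrow> computable n h \<Longrightarrow>
    computable_rel n (\<lambda>xs. code_session (f xs) (g xs) (h xs))"
  unfolding code_session_def
  by (rule computable_code_reg computable_code_fresh computable_intros | assumption)+

lemma computable_code_state:
  "computable n f \<Longrightarrow> computable n g \<Longrightarrow> computable n h \<Longrightarrow>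
    computable n (\<lambda>xs. code_state (f xs) (g xs) (h xs))"
  unfolding code_state_def by (rule computable_intros | assumption)+

lemma computable_code_run:
  "computable n f \<Longrightarrow> computable n g \<Longrightarrow> computable n h \<Longrightarrow>
    computable_rel n (\<lambda>xs. code_run (f xs) (g xs) (h xs))"
  unfolding code_run_def
  by (rule computable_code_reg computable_code_fresh computable_code_state computable_intros
      | assumption)+

lemma computable_code_update:
  "computable n f \<Longrightarrow> computable n g \<Longrightarrow> computable n h \<Longrightarrow> computable n k \<Longrightarrow>
    computable n (\<lambda>xs. code_update (f xs) (g xs) (h xs) (k xs))"
  unfolding code_update_def by (rule computable_intros | assumption)+

lemma computable_eval_clause:
  "computable m V \<Longrightarrow> computable m n \<Longrightarrow> computable m u \<Longrightarrow> computable m t \<Longrightarrow> computable m p \<Longrightarrow>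
    computable m v \<Longrightarrow>
    computable_rel m (\<lambda>xs. eval_clause (V xs) (n xs) (u xs) (t xs) (p xs) (v xs))"
  unfolding eval_clause_def
  by (rule computable_code_session computable_code_update computable_intros | assumption)+

lemma computable_eval_table:
  "computable m V \<Longrightarrow> computable m n \<Longrightarrow> computable m u \<Longrightarrow> computable m M \<Longrightarrow> computable m k \<Longrightarrow>
    computable m (\<lambda>xs. eval_table (V xs) (n xs) (u xs) (M xs) (k xs))"
  unfolding eval_table_def
  by (rule computable_rec_nat computable_eval_clause computable_intros | assumption)+

lemma computable_decide_bound: "computable n f \<Longrightarrow> computable n (\<lambda>xs. decide_bound (f xs))"
  unfolding decide_bound_def tower_def by (rule computable_rec_nat computable_intros | assumption)+

lemma computable_table_size:
  "computable n f \<Longrightarrow> computable n g \<Longrightarrow> computable n (\<lambda>xs. table_size (f xs) (g xs))"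
  unfolding table_size_def by (rule computable_intros | assumption)+

lemma computable_decide: "computable n f \<Longrightarrow> computable_rel n (\<lambda>xs. decide (f xs))"
  unfolding decide_def
  by (rule computable_decide_bound computable_code_run computable_eval_table computable_table_size
      computable_intros | assumption)+

section \<open>Monotonicity and size of codes\<close>

lemma prod_encode_mono: "a \<le> a' \<Longrightarrow> b \<le> b' \<Longrightarrow> prod_encode (a, b) \<le> prod_encode (a', b')"
proof -
  assume le: "a \<le> a'" "b \<le> b'"
  have "triangle m \<le> triangle n" if "m \<le> n" for m n
    using that by (rule lift_Suc_mono_le[rotated]) simp
  then have "triangle (a + b) \<le> triangle (a' + b')" using le by simp
  then show ?thesis using le by (simp add: prod_encode_def)
qed

lemma list_encode_mono: "list_all2 (\<le>) xs ys \<Longrightarrow> list_encode xs \<le> list_encode ys"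
  by (induction rule: list_all2_induct) (auto intro: prod_encode_mono)

lemma set_encode_less:
  assumes "M \<subseteq> {..<n}"
  shows "set_encode M < 2 ^ n"
proof -
  have "set_encode M \<le> set_encode {..<n}"
    using assms finite_subset by (auto simp: set_encode_def intro!: sum_mono2)
  also have "set_encode {..<n} < 2 ^ n"
    by (simp add: set_encode_def lessThan_atLeast0 sum_power2)
  finally show ?thesis .
qed

lemma power_le_of_set_decode: "x \<in> set_decode m \<Longrightarrow> 2 ^ x \<le> m"
  by (rule ccontr) (simp add: set_decode_def)

lemma set_decode_less: "x \<in> set_decode m \<Longrightarrow> x < m"
  using power_le_of_set_decode less_exp less_le_trans by blast

lemma set_decode_subset_lessThan: "m < 2 ^ n \<Longrightarrow> set_decode m \<subseteq> {..<n}"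
proof
  fix x assume "m < 2 ^ n" "x \<in> set_decode m"
  then have "(2 :: nat) ^ x < 2 ^ n" using power_le_of_set_decode le_less_trans by blast
  then show "x \<in> {..<n}" by simp
qed

lemma ex_set_decode_iff: "(\<exists>i < 2 ^ n. P (set_decode i)) \<longleftrightarrow> (\<exists>M \<subseteq> {..<n}. P M)"
proof
  assume "\<exists>i < 2 ^ n. P (set_decode i)"
  then show "\<exists>M \<subseteq> {..<n}. P M" using set_decode_subset_lessThan by blast
next
  assume "\<exists>M \<subseteq> {..<n}. P M"
  then obtain M where M: "M \<subseteq> {..<n}" "P M" by blast
  then have "finite M" by (blast intro: finite_subset)
  with M set_encode_less show "\<exists>i < 2 ^ n. P (set_decode i)" by (metis set_encode_inverse)
qed

lemma dmso_code_vars: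
  "x \<in> free1 \<phi> \<Longrightarrow> x < dmso_code e \<phi>" "X \<in> free2 \<phi> \<Longrightarrow> X < dmso_code e \<phi>"
proof (induction \<phi>)
  case (Neg \<phi>)
  { case 1 then show ?case using Neg dmso_code_less(1)[of e \<phi>] by (auto simp del: dmso_code.simps) next
    case 2 then show ?case using Neg dmso_code_less(1)[of e \<phi>] by (auto simp del: dmso_code.simps) }
next
  case (Or \<phi> \<psi>)
  { case 1 then show ?case using Or dmso_code_less(2,3)[where e = e and \<phi> = \<phi> and \<psi> = \<psi>]
      by (auto simp del: dmso_code.simps) next
    case 2 then show ?case using Or dmso_code_less(2,3)[where e = e and \<phi> = \<phi> and \<psi> = \<psi>]
      by (auto simp del: dmso_code.simps) }
next
  case (Ex1 y \<phi>)
  { case 1 then show ?case using Ex1 dmso_code_less(4)[of e \<phi> y] by (auto simp del: dmso_code.simps) next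
    case 2 then show ?case using Ex1 dmso_code_less(4)[of e \<phi> y] by (auto simp del: dmso_code.simps) }
next
  case (Ex2 Y \<phi>)
  { case 1 then show ?case using Ex2 dmso_code_less(5)[of e \<phi> Y] by (auto simp del: dmso_code.simps) next
    case 2 then show ?case using Ex2 dmso_code_less(5)[of e \<phi> Y] by (auto simp del: dmso_code.simps) }
qed (auto intro!: list_encode_greater simp del: list_encode.simps)

text \<open>Constrains only the first \<open>length u\<close> entries of \<open>U\<close>, since the
  procedure also meets numbers that are not the exact code of \<open>u\<close>.\<close>

definition word_code :: "('a \<Rightarrow> nat) \<Rightarrow> nat \<Rightarrow> (nat, nat, 'a) transition list \<Rightarrow> bool" where
  "word_code e U u \<longleftrightarrow> (\<forall>i < length u. code_nth U i = transition_code e (u ! i))"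

lemma transition_code_nth:
  "code_nth (transition_code e t) 0 = source t"
  "code_nth (transition_code e t) 1 = e (tlabel t)"
  "code_reg (transition_code e t) = treg t"
  "code_fresh (transition_code e t) \<longleftrightarrow> taction t = Fresh (treg t)"
  "code_nth (transition_code e t) 3 = target t"
proof -
  obtain s a p s' where t: "t = (s, (a, p), s')" by (cases t) auto
  show "code_nth (transition_code e t) 0 = source t"
    "code_nth (transition_code e t) 1 = e (tlabel t)"
    "code_nth (transition_code e t) 3 = target t"
    by (simp_all add: t transition_code_def code_nth_list_encode tlabel_def del: list_encode.simps)
  have "code_nth (transition_code e t) 2 = reg_op_code p"
    by (simp add: t transition_code_def code_nth_list_encode del: list_encode.simps)
  then show "code_reg (transition_code e t) = treg t"
    "code_fresh (transition_code e t) \<longleftrightarrow> taction t = Fresh (treg t)"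
    by (cases p; simp add: code_reg_def code_fresh_def t treg_def taction_def)+
qed

lemma code_session_iff:
  assumes "word_code e U u" "i < length u" "j < length u"
  shows "code_session U i j \<longleftrightarrow> same_session u i j"
proof -
  have "code_nth U k = transition_code e (u ! k)" if "k < length u" for k
    using assms(1) that by (simp add: word_code_def)
  then have k: "code_reg (code_nth U k) = treg (u ! k)"
    "code_fresh (code_nth U k) \<longleftrightarrow> taction (u ! k) = Fresh (treg (u ! k))" if "k < length u" for k
    using that by (simp_all add: transition_code_nth)
  have fresh: "taction t = Fresh (treg t) \<and> treg t = r \<longleftrightarrow> taction t = Fresh r"
    for t :: "(nat, nat, 'a) transition" and r
    by (auto simp: treg_def)
  have "(\<forall>k < Suc (i + j). (i < k \<or> j < k) \<and> (k \<le> i \<or> k \<le> j) \<longrightarrow>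
      \<not> (code_fresh (code_nth U k) \<and> code_reg (code_nth U k) = r)) \<longleftrightarrow>
    (\<forall>k. min i j < k \<and> k \<le> max i j \<longrightarrow> taction (u ! k) \<noteq> Fresh r)" for r
  proof -
    have "k < Suc (i + j) \<and> (i < k \<or> j < k) \<and> (k \<le> i \<or> k \<le> j) \<longleftrightarrow> min i j < k \<and> k \<le> max i j" for k
      by auto
    moreover have "code_fresh (code_nth U k) \<and> code_reg (code_nth U k) = r \<longleftrightarrow> taction (u ! k) = Fresh r"
      if "k \<le> max i j" for k
    proof -
      have "k < length u" using that assms(2,3) by (auto simp: le_max_iff_disj)
      then show ?thesis by (simp add: k fresh)
    qed
    ultimately show ?thesis by blast
  qed
  then show ?thesis
    by (simp add: code_session_def same_session_def k assms)
qed

text \<open>Injectivity of \<open>e\<close> makes transition codes injective, so membership of a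
  transition can be tested on its code.\<close>

lemma code_run_iff:
  fixes A :: "(nat, nat, 'a) session_automaton"
  assumes A: "is_session_automaton A" and "inj e" and U: "word_code e U u"
  shows "code_run (automaton_code e A) (length u) U \<longleftrightarrow> symbolic_run A u"
proof -
  have fin: "finite (final A)" "finite (transition_code e ` transitions A)"
    using A by (auto simp: is_session_automaton_def intro: finite_subset)
  have a: "code_nth (automaton_code e A) 2 = initial A"
    "set_decode (code_nth (automaton_code e A) 3) = final A"
    "set_decode (code_nth (automaton_code e A) 4) = transition_code e ` transitions A"
    using fin by (simp_all add: automaton_code_def code_nth_list_encode del: list_encode.simps)
  have nth: "code_nth U i = transition_code e (u ! i)" if "i < length u" for i
    using U that by (simp add: word_code_def)
  have state: "code_state (automaton_code e A) U i = state_after (initial A) u i" if "i \<le> length u" for i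
    using that by (auto simp: code_state_def state_after_def a nth transition_code_nth)
  have mem: "transition_code e t \<in> transition_code e ` transitions A \<longleftrightarrow> t \<in> transitions A" for t
    using inj_transition_code[OF assms(2)] by (simp add: inj_image_mem_iff)
  have init: "(\<exists>j < i. code_fresh (code_nth U j) \<and> code_reg (code_nth U j) = r) \<longleftrightarrow>
    (\<exists>j < i. taction (u ! j) = Fresh r)" if "i < length u" for i r
  proof -
    have "code_fresh (code_nth U j) \<and> code_reg (code_nth U j) = r \<longleftrightarrow> taction (u ! j) = Fresh r" if "j < i" for j
      using that \<open>i < length u\<close> by (auto simp: nth transition_code_nth treg_def)
    then show ?thesis by blast
  qed
  have "u \<in> lists (transitions A) \<longleftrightarrow> (\<forall>i < length u. u ! i \<in> transitions A)"
    by (simp add: in_lists_conv_set all_set_conv_all_nth)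
  then show ?thesis
    unfolding symbolic_run_def symbolic_path_def connected_def initialized_def code_run_def
    by (auto simp: a state nth mem init transition_code_nth)
qed

section \<open>Environments and correctness of the tables\<close>

definition env_code :: "nat \<Rightarrow> nat \<Rightarrow> nat \<Rightarrow> bool" where
  "env_code V n v \<longleftrightarrow> (\<exists>f. v = code_tabulate V f \<and> (\<forall>y < V. f y < 2 ^ n))"

lemma env_code_le: "env_code V n v \<Longrightarrow> v \<le> code_tabulate V (\<lambda>_. 2 ^ n)"
  unfolding env_code_def code_tabulate_eq
  by (auto intro!: list_encode_mono simp: list_all2_conv_all_nth less_imp_le)

lemma env_code_update: "env_code V n v \<Longrightarrow> i < 2 ^ n \<Longrightarrow> env_code V n (code_update V v z i)"
  unfolding env_code_def code_update_def
  by (auto simp: code_nth_tabulate intro!: exI[of _ "\<lambda>y. if y = z then i else code_nth v y"])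

lemma code_nth_update: "y < V \<Longrightarrow> code_nth (code_update V v z i) y = (if y = z then i else code_nth v y)"
  by (simp add: code_update_def code_nth_tabulate)

definition env_fo :: "nat \<Rightarrow> nat \<Rightarrow> nat" where
  "env_fo v x = code_nth v (2 * x)"

definition env_so :: "nat \<Rightarrow> nat \<Rightarrow> nat set" where
  "env_so v X = set_decode (code_nth v (Suc (2 * X)))"

text \<open>An update loses slots from \<open>2 * c\<close> onwards, so the valuations agree only on
  variables with smaller slots; the free variables of \<open>\<phi>\<close> are among them. Parity
  keeps positions and sets apart.\<close>

lemma env_update:
  assumes "dmso_code e \<phi> \<le> c"
  shows "ssat u (env_fo (code_update (2 * c) v (2 * x) i)) (env_so (code_update (2 * c) v (2 * x) i)) \<phi> \<longleftrightarrow>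
      ssat u ((env_fo v)(x := i)) (env_so v) \<phi>"
    and "ssat u (env_fo (code_update (2 * c) v (Suc (2 * x)) i))
        (env_so (code_update (2 * c) v (Suc (2 * x)) i)) \<phi> \<longleftrightarrow>
      ssat u (env_fo v) ((env_so v)(x := set_decode i)) \<phi>"
proof -
  have less: "y < c" if "y \<in> free1 \<phi>" for y
    using dmso_code_vars(1)[OF that, of e] assms by simp
  have less': "Suc (2 * y) < 2 * c" if "y \<in> free2 \<phi>" for y
    using dmso_code_vars(2)[OF that, of e] assms by simp
  have neq: "2 * a \<noteq> Suc (2 * b)" "Suc (2 * a) \<noteq> 2 * b" for a b :: nat by presburger+
  show "ssat u (env_fo (code_update (2 * c) v (2 * x) i)) (env_so (code_update (2 * c) v (2 * x) i)) \<phi> \<longleftrightarrow>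
      ssat u ((env_fo v)(x := i)) (env_so v) \<phi>"
    by (rule ssat_cong) (auto simp: env_fo_def env_so_def code_nth_update less less' neq)
  show "ssat u (env_fo (code_update (2 * c) v (Suc (2 * x)) i))
        (env_so (code_update (2 * c) v (Suc (2 * x)) i)) \<phi> \<longleftrightarrow>
      ssat u (env_fo v) ((env_so v)(x := set_decode i)) \<phi>"
    by (rule ssat_cong) (auto simp: env_fo_def env_so_def code_nth_update less less' neq)
qed

lemma eval_clause_dmso_code:
  "eval_clause V n u t (dmso_code e (Label x a)) v \<longleftrightarrow> code_nth (code_nth u (env_fo v x)) 1 = e a"
  "eval_clause V n u t (dmso_code e (Eq x y)) v \<longleftrightarrow> env_fo v x = env_fo v y"
  "eval_clause V n u t (dmso_code e (Succ x y)) v \<longleftrightarrow> env_fo v y = Suc (env_fo v x)"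
  "eval_clause V n u t (dmso_code e (Sim x y)) v \<longleftrightarrow> code_session u (env_fo v x) (env_fo v y)"
  "eval_clause V n u t (dmso_code e (Mem x X)) v \<longleftrightarrow> env_fo v x \<in> env_so v X"
  "eval_clause V n u t (dmso_code e (Neg \<phi>)) v \<longleftrightarrow> code_nth t (prod_encode (dmso_code e \<phi>, v)) = 0"
  "eval_clause V n u t (dmso_code e (Or \<phi> \<psi>)) v \<longleftrightarrow>
    \<not> code_nth t (prod_encode (dmso_code e \<phi>, v)) = 0 \<or>
    \<not> code_nth t (prod_encode (dmso_code e \<psi>, v)) = 0"
  "eval_clause V n u t (dmso_code e (Ex1 x \<phi>)) v \<longleftrightarrow>
    (\<exists>i < n. \<not> code_nth t (prod_encode (dmso_code e \<phi>, code_update V v (2 * x) i)) = 0)"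
  "eval_clause V n u t (dmso_code e (Ex2 X \<phi>)) v \<longleftrightarrow>
    (\<exists>i < 2 ^ n. \<not> code_nth t (prod_encode (dmso_code e \<phi>, code_update V v (Suc (2 * X)) i)) = 0)"
  by (simp_all add: eval_clause_def code_nth_list_encode env_fo_def env_so_def del: list_encode.simps)

lemma eval_table_Suc:
  assumes "p \<le> c" "env_code (2 * c) n v"
  shows "code_nth (eval_table (2 * c) n U (table_size c n) (Suc k)) (prod_encode (p, v)) = 0 \<longleftrightarrow>
    \<not> eval_clause (2 * c) n U (eval_table (2 * c) n U (table_size c n) k) p v"
proof -
  have "prod_encode (p, v) < table_size c n"
    unfolding table_size_def using prod_encode_mono[OF assms(1) env_code_le[OF assms(2)]] by simp
  then show ?thesis unfolding eval_table_def by (auto simp: code_nth_tabulate)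
qed

text \<open>Round and environment vary in the induction: a part is looked up one round earlier,
  which is still above its code, and quantifiers change the environment.\<close>

lemma eval_table_correct:
  assumes "inj e" and U: "word_code e U u"
    and "dmso_code e \<phi> < k" "dmso_code e \<phi> \<le> c" "env_code (2 * c) (length u) v"
    and "\<And>x. x \<in> free1 \<phi> \<Longrightarrow> env_fo v x < length u"
  shows "code_nth (eval_table (2 * c) (length u) U (table_size c (length u)) k)
      (prod_encode (dmso_code e \<phi>, v)) = 0 \<longleftrightarrow> \<not> ssat u (env_fo v) (env_so v) \<phi>"
proof -
  let ?n = "length u"
  let ?tab = "eval_table (2 * c) ?n U (table_size c ?n)"
  have pos: "\<exists>k'. k = Suc k'" if "m < k" for m k :: nat using that by (cases k) auto
  show ?thesis
    using assms(3-)
  proof (induction \<phi> arbitrary: k v)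
    case (Label x a)
    obtain k' where k: "k = Suc k'" using pos[OF Label.prems(1)] by blast
    have "env_fo v x < ?n" using Label.prems(4) by simp
    then show ?case
      using U inj_eq[OF assms(1)] unfolding k eval_table_Suc[OF Label.prems(2,3)] eval_clause_dmso_code
      by (simp add: word_code_def transition_code_nth del: One_nat_def)
  next
    case (Eq x y)
    obtain k' where k: "k = Suc k'" using pos[OF Eq.prems(1)] by blast
    show ?case unfolding k eval_table_Suc[OF Eq.prems(2,3)] eval_clause_dmso_code by simp
  next
    case (Succ x y)
    obtain k' where k: "k = Suc k'" using pos[OF Succ.prems(1)] by blast
    show ?case unfolding k eval_table_Suc[OF Succ.prems(2,3)] eval_clause_dmso_code by simp
  next
    case (Sim x y)
    obtain k' where k: "k = Suc k'" using pos[OF Sim.prems(1)] by blast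
    have "env_fo v x < ?n" "env_fo v y < ?n" using Sim.prems(4) by auto
    then show ?case
      using code_session_iff[OF U] unfolding k eval_table_Suc[OF Sim.prems(2,3)] eval_clause_dmso_code
      by simp
  next
    case (Mem x X)
    obtain k' where k: "k = Suc k'" using pos[OF Mem.prems(1)] by blast
    show ?case unfolding k eval_table_Suc[OF Mem.prems(2,3)] eval_clause_dmso_code by simp
  next
    case (Neg \<phi>)
    obtain k' where k: "k = Suc k'" using pos[OF Neg.prems(1)] by blast
    have "code_nth (?tab k') (prod_encode (dmso_code e \<phi>, v)) = 0 \<longleftrightarrow> \<not> ssat u (env_fo v) (env_so v) \<phi>"
      by (rule Neg.IH) (use Neg.prems k dmso_code_less(1)[of e \<phi>] in \<open>auto simp del: dmso_code.simps\<close>)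
    then show ?case unfolding k eval_table_Suc[OF Neg.prems(2,3)] eval_clause_dmso_code by simp
  next
    case (Or \<phi> \<psi>)
    obtain k' where k: "k = Suc k'" using pos[OF Or.prems(1)] by blast
    note less = dmso_code_less(2,3)[where e = e and \<phi> = \<phi> and \<psi> = \<psi>]
    have "code_nth (?tab k') (prod_encode (dmso_code e \<phi>, v)) = 0 \<longleftrightarrow> \<not> ssat u (env_fo v) (env_so v) \<phi>"
      by (rule Or.IH(1)) (use Or.prems k less in \<open>auto simp del: dmso_code.simps\<close>)
    moreover have "code_nth (?tab k') (prod_encode (dmso_code e \<psi>, v)) = 0 \<longleftrightarrow>
        \<not> ssat u (env_fo v) (env_so v) \<psi>"
      by (rule Or.IH(2)) (use Or.prems k less in \<open>auto simp del: dmso_code.simps\<close>)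
    ultimately show ?case unfolding k eval_table_Suc[OF Or.prems(2,3)] eval_clause_dmso_code by simp
  next
    case (Ex1 x \<phi>)
    obtain k' where k: "k = Suc k'" using pos[OF Ex1.prems(1)] by blast
    note less = dmso_code_less(4)[of e \<phi> x]
    have \<phi>_le: "dmso_code e \<phi> \<le> c" using less Ex1.prems(2) by simp
    have "code_nth (?tab k') (prod_encode (dmso_code e \<phi>, code_update (2 * c) v (2 * x) i)) = 0 \<longleftrightarrow>
        \<not> ssat u ((env_fo v)(x := i)) (env_so v) \<phi>" if "i < ?n" for i
      unfolding env_update(1)[OF \<phi>_le, symmetric]
    proof (rule Ex1.IH)
      \<comment> \<open>The bound \<open>2 ^ ?n\<close> on slots is made for set codes; a position
        meets it because \<open>i < ?n < 2 ^ ?n\<close>.\<close>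
      show "env_code (2 * c) ?n (code_update (2 * c) v (2 * x) i)"
        using Ex1.prems(3) less_trans[OF that less_exp] by (rule env_code_update)
    next
      fix y assume y: "y \<in> free1 \<phi>"
      then have "2 * y < 2 * c" using dmso_code_vars(1)[OF y, of e] \<phi>_le by simp
      then show "env_fo (code_update (2 * c) v (2 * x) i) y < ?n"
        using Ex1.prems(4)[of y] y that by (auto simp: env_fo_def code_nth_update)
    qed (use Ex1.prems k less \<phi>_le in \<open>auto simp del: dmso_code.simps\<close>)
    then show ?case unfolding k eval_table_Suc[OF Ex1.prems(2,3)] eval_clause_dmso_code by simp
  next
    case (Ex2 X \<phi>)
    obtain k' where k: "k = Suc k'" using pos[OF Ex2.prems(1)] by blast
    note less = dmso_code_less(5)[of e \<phi> X]
    have \<phi>_le: "dmso_code e \<phi> \<le> c" using less Ex2.prems(2) by simp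
    have "code_nth (?tab k') (prod_encode (dmso_code e \<phi>, code_update (2 * c) v (Suc (2 * X)) i)) = 0 \<longleftrightarrow>
        \<not> ssat u (env_fo v) ((env_so v)(X := set_decode i)) \<phi>" if "i < 2 ^ ?n" for i
      unfolding env_update(2)[OF \<phi>_le, symmetric]
    proof (rule Ex2.IH)
      show "env_code (2 * c) ?n (code_update (2 * c) v (Suc (2 * X)) i)"
        using Ex2.prems(3) that by (rule env_code_update)
    next
      fix y assume y: "y \<in> free1 \<phi>"
      then have "2 * y < 2 * c" using dmso_code_vars(1)[OF y, of e] \<phi>_le by simp
      moreover have "2 * y \<noteq> Suc (2 * X)" by presburger
      ultimately show "env_fo (code_update (2 * c) v (Suc (2 * X)) i) y < ?n"
        using Ex2.prems(4)[of y] y by (auto simp: env_fo_def code_nth_update)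
    qed (use Ex2.prems k less \<phi>_le in \<open>auto simp del: dmso_code.simps\<close>)
    then show ?case
      unfolding k eval_table_Suc[OF Ex2.prems(2,3)] eval_clause_dmso_code ssat.simps
        ex_set_decode_iff[symmetric, where P = "\<lambda>M. ssat u (env_fo v) ((env_so v)(X := M)) \<phi>"]
      by simp
  qed
qed

text \<open>An element of a finite set is smaller than the code of the set, which is smaller than
  the code of a list containing it.\<close>

lemma automaton_code_bounds:
  fixes A :: "(nat, nat, 'a) session_automaton"
  assumes A: "is_session_automaton A"
  shows "card (states A) \<le> automaton_code e A" "card (registers A) \<le> automaton_code e A"
    "\<And>t. t \<in> transitions A \<Longrightarrow> transition_code e t \<le> automaton_code e A"
proof -
  have fin: "finite (states A)" "finite (registers A)" "finite (transition_code e ` transitions A)"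
    using A by (auto simp: is_session_automaton_def)
  have less: "set_encode X < automaton_code e A"
    if "X \<in> {states A, registers A, transition_code e ` transitions A}" for X
    using that unfolding automaton_code_def
    by (auto intro!: list_encode_greater simp del: list_encode.simps)
  have elem: "x < automaton_code e A"
    if "x \<in> X" "finite X" "X \<in> {states A, registers A, transition_code e ` transitions A}" for x X
    using set_decode_less[of x "set_encode X"] less[OF that(3)] that(1,2)
    by (simp add: set_encode_inverse)
  have "states A \<subseteq> {..<automaton_code e A}" "registers A \<subseteq> {..<automaton_code e A}"
    using elem fin by auto
  then show "card (states A) \<le> automaton_code e A" "card (registers A) \<le> automaton_code e A"
    using card_mono[of "{..<automaton_code e A}"] by force+
  show "transition_code e t \<le> automaton_code e A" if "t \<in> transitions A" for t
    using elem[OF imageI[OF that] fin(3)] by (simp add: less_imp_le)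
qed

lemma decide_correct:
  fixes A :: "(nat, nat, 'a) session_automaton"
  assumes A: "is_session_automaton A" and \<phi>: "is_sentence \<phi>" and "inj e"
  shows "decide (instance_code e (A, \<phi>)) \<longleftrightarrow>
    (\<forall>u. symbolic_run A u \<longrightarrow> ssat u (\<lambda>_. 0) (\<lambda>_. {}) \<phi>)"
proof -
  let ?a = "automaton_code e A" and ?p = "dmso_code e \<phi>"
  define c where "c = instance_code e (A, \<phi>)"
  let ?v = "code_tabulate (2 * c) (\<lambda>_. 0)"
  have dec: "prod_decode c = (?a, ?p)" by (simp add: c_def instance_code_def)
  have le: "?a \<le> c" "?p \<le> c"
    unfolding c_def instance_code_def by (simp_all add: le_prod_encode_1 le_prod_encode_2)
  have eval: "code_nth (eval_table (2 * c) (length u) U (table_size c (length u)) (Suc c))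
      (prod_encode (?p, ?v)) = 0 \<longleftrightarrow> \<not> ssat u (\<lambda>_. 0) (\<lambda>_. {}) \<phi>" if "word_code e U u" for u U
  proof -
    have "env_code (2 * c) (length u) ?v"
      unfolding env_code_def by (intro exI[of _ "\<lambda>_. 0"]) simp
    then have "code_nth (eval_table (2 * c) (length u) U (table_size c (length u)) (Suc c))
      (prod_encode (?p, ?v)) = 0 \<longleftrightarrow> \<not> ssat u (env_fo ?v) (env_so ?v) \<phi>"
      by (intro eval_table_correct) (use assms that le in \<open>auto simp: is_sentence_def\<close>)
    also have "ssat u (env_fo ?v) (env_so ?v) \<phi> \<longleftrightarrow> ssat u (\<lambda>_. 0) (\<lambda>_. {}) \<phi>"
      by (rule ssat_cong) (use \<phi> in \<open>auto simp: is_sentence_def\<close>)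
    finally show ?thesis .
  qed
  have "decide c \<longleftrightarrow> (\<forall>u. symbolic_run A u \<longrightarrow> ssat u (\<lambda>_. 0) (\<lambda>_. {}) \<phi>)"
  proof
    assume dec_c: "decide c"
    show "\<forall>u. symbolic_run A u \<longrightarrow> ssat u (\<lambda>_. 0) (\<lambda>_. {}) \<phi>"
    proof (rule ccontr)
      assume "\<not> ?thesis"
      then obtain u0 where "symbolic_run A u0" "\<not> ssat u0 (\<lambda>_. 0) (\<lambda>_. {}) \<phi>" by blast
      moreover have "card (states A) \<le> c" "card (registers A) \<le> c"
        using automaton_code_bounds(1,2)[OF A, where e = e] le(1) by simp_all
      ultimately obtain u where u: "symbolic_run A u" "\<not> ssat u (\<lambda>_. 0) (\<lambda>_. {}) \<phi>"
        "length u < Suc c * (2 * 2 ^ c) * tower c ?p"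
        using short_symbolic_counterexample[OF A _ _ \<phi>, where e = e] by blast
      have bound: "length u < decide_bound c"
        using u(3) tower_mono[OF le(2), of c] unfolding decide_bound_def
        by (meson less_le_trans mult_le_mono order_refl)
      \<comment> \<open>The code of the short counterexample lies in the searched range because its
        entries are at most \<open>c\<close>.\<close>
      let ?U = "list_encode (map (transition_code e) u)"
      have U: "word_code e ?U u" by (simp add: word_code_def code_nth_list_encode)
      have "transition_code e t \<le> c" if "t \<in> set u" for t
        using automaton_code_bounds(3)[OF A, where t = t and e = e] le(1) that u(1)
        by (auto simp: symbolic_run_def symbolic_path_def)
      then have "?U \<le> code_tabulate (length u) (\<lambda>_. c)"
        unfolding code_tabulate_eq by (intro list_encode_mono) (auto simp: list_all2_conv_all_nth)
      moreover have "code_run ?a (length u) ?U" using code_run_iff[OF A assms(3) U] u(1) by simp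
      ultimately show False
        using dec_c bound eval[OF U] u(2)
        unfolding decide_def dec fst_conv snd_conv less_Suc_eq_le by blast
    qed
  next
    assume sound: "\<forall>u. symbolic_run A u \<longrightarrow> ssat u (\<lambda>_. 0) (\<lambda>_. {}) \<phi>"
    show "decide c"
      unfolding decide_def dec fst_conv snd_conv
    proof (intro allI impI)
      fix n U assume run: "code_run ?a n U"
      \<comment> \<open>The first \<open>n\<close> entries of a number that passes the run test are
        transition codes, so it stands for an actual sequence even if it is not the code of that
        sequence.\<close>
      have "set_decode (code_nth ?a 4) = transition_code e ` transitions A"
        using A by (simp add: automaton_code_def code_nth_list_encode is_session_automaton_def
            set_encode_inverse del: list_encode.simps)
      then have "\<forall>i < n. \<exists>t. code_nth U i = transition_code e t"
        using run unfolding code_run_def by blast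
      then obtain f where f: "\<And>i. i < n \<Longrightarrow> code_nth U i = transition_code e (f i)" by metis
      define u where "u = map f [0..<n]"
      have U: "word_code e U u" and n: "length u = n" by (simp_all add: word_code_def u_def f)
      have "symbolic_run A u" using code_run_iff[OF A assms(3) U] run n by simp
      with sound eval[OF U]
      show "\<not> code_nth (eval_table (2 * c) n U (table_size c n) (Suc c)) (prod_encode (?p, ?v)) = 0"
        unfolding n by blast
    qed
  qed
  then show ?thesis unfolding c_def .
qed

theorem theorem4p2:
  fixes e :: "'a::finite \<Rightarrow> nat"
  assumes "inj e" and "infinite (UNIV :: 'd set)"
  shows "decidable_problem (instance_code e)
    {(A, \<phi>). is_session_automaton A \<and> is_sentence \<phi>}
    (\<lambda>(A, \<phi>). (automaton_lang A :: ('a \<times> 'd) list set) \<subseteq> dmso_lang \<phi>)"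
proof -
  have "computable (Suc 0) (\<lambda>xs. of_bool (decide (hd xs)))"
    by (intro computable_of_bool computable_decide computable_hd)
  then obtain f where f: "recursive_fn 1 f" "\<And>xs. length xs = 1 \<Longrightarrow> of_bool (decide (hd xs)) = f xs"
    unfolding computable_def by auto
  have "f [instance_code e (A, \<phi>)] =
      (if (automaton_lang A :: ('a \<times> 'd) list set) \<subseteq> dmso_lang \<phi> then 1 else 0)"
    if "is_session_automaton A" "is_sentence \<phi>" for A \<phi>
  proof -
    have "f [instance_code e (A, \<phi>)] = of_bool (decide (instance_code e (A, \<phi>)))"
      using f(2)[of "[instance_code e (A, \<phi>)]"] by simp
    then show ?thesis
      unfolding decide_correct[OF that assms(1)] inclusion_iff_symbolic[OF assms(2) that(2), of A]
      by (simp only: of_bool_def)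
  qed
  with f(1) show ?thesis
    unfolding decidable_problem_def
    by (intro conjI inj_on_instance_code[OF assms(1)] exI[of _ f]) auto
qed

end
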